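(* Let $a,b\in\mathbb D$ with $a\ne b$. For $\varepsilon\in\mathbb C\setminus\{0\}$ let $L^\varepsilon_{a0bV}$ denote Coman's Lempert function on $\mathbb D^2$ with the three poles $(a,0),(b,0),(b,\varepsilon)$, all of weight $1$. Then for every $z\in\mathbb D^2$, $$\lim_{\varepsilon\to0}L^\varepsilon_{a0bV}(z)=\min\{L_{a0bV}(z),L_{a0b0}(z)\}.$$
   Context: $\mathbb D$ is the open unit disc; maps $\varphi=(\varphi_1,\varphi_2)$ are holomorphic $\mathbb D\to\mathbb D^2$. Coman's Lempert function with poles $p_1,\dots,p_k$ of weight 1: $\inf\{\sum_{j}\log|\zeta_j|:\varphi(0)=z,\ \zeta_j\in\mathbb D,\ \varphi(\zeta_j)=p_j\}$. $L_{a0b0}(z)=\inf\{\log|\zeta_1|+\log|\zeta_2|:\varphi(0)=z,\varphi(\zeta_1)=(a,0),\varphi(\zeta_2)=(b,0)\}$. $L_{a0bV}(z)=\inf\{\log|\zeta_1|+2\log|\zeta_2|:\varphi(0)=z,\varphi(\zeta_1)=(a,0),\varphi(\zeta_2)=(b,0),\varphi_1'(\zeta_2)=0\}$. *)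

theory Defs
  imports "HOL-Analysis.Analysis"
begin

definition elog :: "real \<Rightarrow> ereal" where
  "elog r = (if r = 0 then -\<infinity> else ereal (ln r))"

definition disc_to_bidisc :: "(complex \<Rightarrow> complex) \<Rightarrow> (complex \<Rightarrow> complex) \<Rightarrow> bool" where
  "disc_to_bidisc f g \<longleftrightarrow>
     f holomorphic_on ball 0 1 \<and> g holomorphic_on ball 0 1 \<and>
     f ` ball 0 1 \<subseteq> ball 0 1 \<and> g ` ball 0 1 \<subseteq> ball 0 1"

definition coman_lempert :: "(complex \<times> complex) list \<Rightarrow> complex \<times> complex \<Rightarrow> ereal" where
  "coman_lempert ps z = Inf {(\<Sum>j<length ps. elog (norm (\<zeta> j))) | f g \<zeta>.
      disc_to_bidisc f g \<and> (f 0, g 0) = z \<and>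
      (\<forall>j<length ps. \<zeta> j \<in> ball 0 1 \<and> (f (\<zeta> j), g (\<zeta> j)) = ps ! j)}"

definition L_a0bV :: "complex \<Rightarrow> complex \<Rightarrow> complex \<times> complex \<Rightarrow> ereal" where
  "L_a0bV a b z = Inf {elog (norm \<zeta>1) + 2 * elog (norm \<zeta>2) | f g \<zeta>1 \<zeta>2.
      disc_to_bidisc f g \<and> (f 0, g 0) = z \<and>
      \<zeta>1 \<in> ball 0 1 \<and> \<zeta>2 \<in> ball 0 1 \<and>
      (f \<zeta>1, g \<zeta>1) = (a, 0) \<and> (f \<zeta>2, g \<zeta>2) = (b, 0) \<and> deriv f \<zeta>2 = 0}"

end

theory Submission
  imports Defs "HOL-Complex_Analysis.Riemann_Mapping"
begin

text \<open>
  By the Schwarz lemma every competitor for the three poles satisfies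
  \<open>|\<zeta>\<^sub>1 \<zeta>\<^sub>2 \<zeta>\<^sub>3| \<ge> \<rho>(z\<^sub>1, a) \<rho>(z\<^sub>1, b)\<close>, where \<open>\<rho>\<close> is the pseudohyperbolic distance, and
  \<open>|\<zeta>\<^sub>1 \<zeta>\<^sub>2 \<zeta>\<^sub>3| \<ge> |z\<^sub>2| - O(|\<epsilon>| / \<rho>(\<zeta>\<^sub>2, \<zeta>\<^sub>3))\<close>. On the other hand the Lempert function
  with the two poles is at most \<open>log max {|z\<^sub>2|, \<rho>(z\<^sub>1, a) \<rho>(z\<^sub>1, b)}\<close>. Hence the three-pole function
  can only drop below the two-pole function if \<open>\<zeta>\<^sub>2\<close> and \<open>\<zeta>\<^sub>3\<close> merge at an interior point. There
  the first coordinate takes the value \<open>b\<close> twice in the limit (Montel), which is a competitor for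
  \<open>L_a0bV\<close>; should \<open>\<zeta>\<^sub>1\<close> escape to the boundary, it is reinstated by the Schur algorithm.
  Conversely, the Schur algorithm adds a third node near the boundary to any competitor for the two
  poles, and a competitor for \<open>L_a0bV\<close> is perturbed by a small polynomial after splitting its
  double node.
\<close>

subsection \<open>Moebius maps and the Schur algorithm\<close>

text \<open>With rotation angle 0 this is \<open>(z - w) / (1 - cnj w * z)\<close>. For
  \<open>w\<close> in the disc it is the automorphism that sends \<open>w\<close> to 0, with inverse
  \<open>mob (-w)\<close>; its modulus is the pseudohyperbolic distance of \<open>w\<close> and
  \<open>z\<close>.\<close>

abbreviation mob :: "complex \<Rightarrow> complex \<Rightarrow> complex" where
  "mob \<equiv> Moebius_function 0"

lemma mob_denom_nonzero:
  assumes "norm w < 1" "norm z < 1"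
  shows "1 - cnj w * z \<noteq> 0"
proof -
  have "norm (cnj w * z) < 1"
    using norm_mult_less[of "cnj w" 1 z 1] assms by simp
  then show ?thesis by auto
qed

lemma mob_inverse:
  assumes "norm w < 1" "norm z < 1"
  shows "mob (-w) (mob w z) = z" "mob w (mob (-w) z) = z"
  using assms by (auto intro: Moebius_function_compose)

lemma mob_inj:
  assumes "norm w < 1" "norm x < 1" "norm y < 1" "mob w x = mob w y"
  shows "x = y"
  using assms mob_inverse(1) by metis

lemma mob_eq_0_iff:
  assumes "norm w < 1" "norm z < 1"
  shows "mob w z = 0 \<longleftrightarrow> z = w"
  using assms mob_inj[of w z w] by (auto simp: Moebius_function_eq_zero)

lemma norm_mob_0 [simp]: "norm (mob w 0) = norm w"
  by (simp add: Moebius_function_of_zero)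

lemma mob_comp_holomorphic:
  assumes "f holomorphic_on S" "\<And>z. z \<in> S \<Longrightarrow> norm (f z) < 1" "norm w < 1"
  shows "(\<lambda>z. mob w (f z)) holomorphic_on S"
  using holomorphic_on_compose_gen[OF assms(1) Moebius_function_holomorphic[OF assms(3)]] assms(2)
  by (auto simp: o_def image_subset_iff)

section \<open>Division by a Blaschke factor\<close>

text \<open>After the zero is moved to the origin, the Schwarz lemma gives the quotient the same
  bound. The bound is not strict, so that the quotient can be divided again at a further
  zero.\<close>

lemma Schwarz_factor:
  assumes holf: "f holomorphic_on ball 0 1" and bd: "\<And>z. norm z < 1 \<Longrightarrow> norm (f z) \<le> M"
    and s: "norm s < 1" "f s = 0"
  obtains h where "h holomorphic_on ball 0 1" "\<And>z. norm z < 1 \<Longrightarrow> norm (h z) \<le> M"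
    "\<And>z. norm z < 1 \<Longrightarrow> f z = mob s z * h z"
proof -
  define F where "F = (\<lambda>z. f (mob (-s) z))"
  have lt: "norm (mob (-s) z) < 1" "norm (mob s z) < 1" if "norm z < 1" for z
    using Moebius_function_norm_lt_1 s that by auto
  have holF: "F holomorphic_on ball 0 1"
    unfolding F_def
    using holomorphic_on_compose_gen[OF Moebius_function_holomorphic[of "-s" 0] holf] s lt
    by (auto simp: o_def image_subset_iff)
  have F0: "F 0 = 0"
    by (simp add: F_def Moebius_function_of_zero s)
  obtain k where k: "k holomorphic_on ball 0 1" "\<And>z. norm z < 1 \<Longrightarrow> F z = z * k z"
    "deriv F 0 = k 0"
    using Schwarz3[OF holF F0] by blast
  have M0: "0 \<le> M"
    using bd[of 0] by (metis norm_ge_zero norm_zero order_trans zero_less_one)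
  have kM: "norm (k z) \<le> M" if z: "norm z < 1" for z
  proof (rule dense_le)
    \<comment> \<open>The Schwarz lemma asks for values strictly inside the disc, so
      \<open>F\<close> is divided by each \<open>M' > M\<close>; then \<open>M'\<close> tends to
      \<open>M\<close>.\<close>
    have "norm (k z) \<le> M'" if M': "M < M'" for M'
    proof -
      have "M' > 0" using M0 M' by linarith
      let ?G = "\<lambda>z. F z / of_real M'"
      have holG: "?G holomorphic_on ball 0 1"
        using holF \<open>M' > 0\<close> by (intro holomorphic_intros) auto
      have G0: "?G 0 = 0" by (simp add: F0)
      have G1: "norm (?G x) < 1" if "norm x < 1" for x
        using bd[OF lt(1)[OF that]] M' \<open>M' > 0\<close> by (simp add: F_def norm_divide field_simps)
      show ?thesis
      proof (cases "z = 0")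
        \<comment> \<open>At the origin the quotient is \<open>deriv F 0\<close>, which the
          derivative part of the Schwarz lemma bounds.\<close>
        case True
        have "F field_differentiable at 0"
          using holF by (simp add: holomorphic_on_imp_differentiable_at)
        then have "deriv ?G 0 = deriv F 0 / of_real M'"
          by (simp add: deriv_cdivide_right)
        then have "norm (k 0 / of_real M') \<le> 1"
          using Schwarz_Lemma(2)[OF holG G0 G1, of 0] k(3) by simp
        then show ?thesis
          using True \<open>M' > 0\<close> by (simp add: norm_divide field_simps)
      next
        case False
        have "norm (?G z) \<le> norm z"
          by (rule Schwarz_Lemma(1)[OF holG G0 G1 z])
        then have "norm z * norm (k z) \<le> norm z * M'"
          using k(2)[OF z] \<open>M' > 0\<close> by (simp add: norm_divide norm_mult field_simps)
        then show ?thesis using False by simp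
      qed
    qed
    then show "y \<le> M" if "y < norm (k z)" for y
      using that by (meson dense_ge less_le_not_le linorder_not_less order_trans)
  qed
  show thesis
  proof
    show "(\<lambda>z. k (mob s z)) holomorphic_on ball 0 1"
      using holomorphic_on_compose_gen[OF Moebius_function_holomorphic[of s 0] k(1)] s lt
      by (auto simp: o_def image_subset_iff)
    fix z :: complex assume z: "norm z < 1"
    show "norm (k (mob s z)) \<le> M" using kM lt z by blast
    show "f z = mob s z * k (mob s z)"
      using k(2)[OF lt(2)[OF z]] mob_inverse(1)[OF s(1) z] by (simp add: F_def)
  qed
qed

text \<open>Compactness of \<open>cball 0 k\<close> makes the strict bound uniform; for negative
  \<open>k\<close> there is no point to bound.\<close>

lemma disc_map_bounded_on_smaller_disc:
  assumes "f holomorphic_on ball 0 1" "\<And>z. norm z < 1 \<Longrightarrow> norm (f z) < 1" "k < 1"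
  obtains \<rho> :: real where "0 \<le> \<rho>" "\<rho> < 1" "\<And>z. norm z \<le> k \<Longrightarrow> norm (f z) \<le> \<rho>"
proof (cases "0 \<le> k")
  case True
  have "continuous_on (cball 0 k) (\<lambda>z. norm (f z))"
    by (intro continuous_intros holomorphic_on_imp_continuous_on holomorphic_on_subset[OF assms(1)])
       (use assms(3) in auto)
  then obtain x where x: "x \<in> cball 0 k" "\<And>z. z \<in> cball 0 k \<Longrightarrow> norm (f z) \<le> norm (f x)"
    using continuous_attains_sup[of "cball 0 k" "\<lambda>z. norm (f z)"] True by auto
  show thesis
    by (rule that[of "norm (f x)"]) (use x assms in auto)
next
  case False
  show thesis
    by (rule that[of 0]) (use False in \<open>auto dest: order_trans[OF norm_ge_zero]\<close>)
qed

text \<open>The inverse \<open>mob (-s)\<close> keeps the disc of radius \<open>t\<close> inside a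
  disc of radius \<open>\<rho> < 1\<close>, so no point outside the latter can be sent into the
  former.\<close>

lemma mob_near_boundary:
  assumes "norm s < 1" "t < 1"
  obtains R where "R < 1" "\<And>\<xi>. R < norm \<xi> \<Longrightarrow> norm \<xi> < 1 \<Longrightarrow> t < norm (mob s \<xi>)"
proof -
  obtain \<rho> where \<rho>: "\<rho> < 1" "\<And>z. norm z \<le> t \<Longrightarrow> norm (mob (-s) z) \<le> \<rho>"
    using disc_map_bounded_on_smaller_disc[of "mob (-s)" t] assms
    by (metis Moebius_function_holomorphic Moebius_function_norm_lt_1 norm_minus_cancel)
  show thesis
  proof
    show "\<rho> < 1" by fact
    fix \<xi> :: complex assume "\<rho> < norm \<xi>" "norm \<xi> < 1"
    then show "t < norm (mob s \<xi>)"
      using \<rho>(2)[of "mob s \<xi>"] mob_inverse(1)[OF assms(1)] by force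
  qed
qed

text \<open>The explicit factor shows that a difference divisible by the node polynomial stays so
  after \<open>mob w\<close>; this carries the identity of \<open>add_node\<close> through each
  step.\<close>

lemma mob_diff:
  assumes "norm w < 1" "norm x < 1" "norm y < 1"
  shows "mob w x - mob w y = (x - y) * ((1 - cnj w * w) / ((1 - cnj w * x) * (1 - cnj w * y)))"
  using mob_denom_nonzero[OF assms(1,2)] mob_denom_nonzero[OF assms(1,3)]
  unfolding Moebius_function_simple by (simp add: divide_simps) (simp add: algebra_simps)

text \<open>The Schur algorithm: peeling off the nodes one by one reduces the claim to the case without
  nodes. Repeated entries of the list prescribe derivatives.\<close>

lemma add_node:
  fixes f :: "complex \<Rightarrow> complex"
  assumes "f holomorphic_on ball 0 1" "\<And>z. norm z < 1 \<Longrightarrow> norm (f z) \<le> \<rho>" "\<rho> < 1"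
    "\<And>s. s \<in> set ss \<Longrightarrow> norm s < 1" "r < 1"
  shows "\<exists>R<1. \<forall>\<xi> w. R < norm \<xi> \<longrightarrow> norm \<xi> < 1 \<longrightarrow> norm w \<le> r \<longrightarrow>
     (\<exists>F k. F holomorphic_on ball 0 1 \<and> k holomorphic_on ball 0 1 \<and>
        (\<forall>z. norm z < 1 \<longrightarrow> norm (F z) < 1) \<and> F \<xi> = w \<and>
        (\<forall>z. norm z < 1 \<longrightarrow> F z = f z + (\<Prod>s\<leftarrow>ss. z - s) * k z))"
  using assms
proof (induction ss arbitrary: f \<rho> r)
  case Nil
  show ?case
  proof (rule exI[of _ 0], intro conjI allI impI)
    \<comment> \<open>Without nodes the constant map \<open>w\<close> works for every
      \<open>\<xi>\<close>, with \<open>k = w - f\<close>.\<close>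
    fix \<xi> w :: complex assume "norm w \<le> r"
    then show "\<exists>F k. F holomorphic_on ball 0 1 \<and> k holomorphic_on ball 0 1 \<and>
        (\<forall>z. norm z < 1 \<longrightarrow> norm (F z) < 1) \<and> F \<xi> = w \<and>
        (\<forall>z. norm z < 1 \<longrightarrow> F z = f z + (\<Prod>s\<leftarrow>[]. z - s) * k z)"
      using Nil by (rule_tac exI[of _ "\<lambda>_. w"], rule_tac exI[of _ "\<lambda>z. w - f z"]) (auto intro!: holomorphic_intros)
  qed simp
next
  case (Cons s ss)
  have s: "norm s < 1" using Cons.prems by auto
  define c where "c = f s"
  have c: "norm c < 1" unfolding c_def using Cons.prems(2,3) s by fastforce
  have f1: "norm (f z) < 1" if "norm z < 1" for z
    using Cons.prems(2)[OF that] Cons.prems(3) by linarith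
  \<comment> \<open>One radius has to serve the values of \<open>f\<close> and the targets
    \<open>w\<close>, hence the disc of radius \<open>max \<rho> r\<close>.\<close>
  obtain \<rho>' where \<rho>': "0 \<le> \<rho>'" "\<rho>' < 1" "\<And>z. norm z \<le> max \<rho> r \<Longrightarrow> norm (mob c z) \<le> \<rho>'"
    using disc_map_bounded_on_smaller_disc[of "mob c" "max \<rho> r"] Cons.prems(3,5)
    by (metis Moebius_function_holomorphic Moebius_function_norm_lt_1 c max_less_iff_conj)
  have holf': "(\<lambda>z. mob c (f z)) holomorphic_on ball 0 1"
    by (rule mob_comp_holomorphic) (use Cons.prems(1) c f1 in auto)
  obtain h where h: "h holomorphic_on ball 0 1" "\<And>z. norm z < 1 \<Longrightarrow> norm (h z) \<le> \<rho>'"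
    "\<And>z. norm z < 1 \<Longrightarrow> mob c (f z) = mob s z * h z"
    by (rule Schwarz_factor[OF holf' _ s, of \<rho>'])
       (use \<rho>'(3) Cons.prems(2) in \<open>auto simp: c_def Moebius_function_eq_zero le_max_iff_disj\<close>)
  \<comment> \<open>Peeling off \<open>s\<close> turns the target into
    \<open>mob c w / mob s \<xi>\<close>, and \<open>r1\<close> leaves room for this growth when
    \<open>\<xi>\<close> is near the boundary. Since the new target depends on \<open>\<xi>\<close>,
    the threshold has to be uniform in \<open>w\<close>.\<close>
  define r1 where "r1 = (1 + \<rho>') / 2"
  have r1: "0 < r1" "r1 < 1" "\<rho>' < r1" using \<rho>' by (auto simp: r1_def)
  obtain R1 where R1: "R1 < 1" and IH: "\<And>\<xi> w. R1 < norm \<xi> \<Longrightarrow> norm \<xi> < 1 \<Longrightarrow> norm w \<le> r1 \<Longrightarrow>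
     (\<exists>F k. F holomorphic_on ball 0 1 \<and> k holomorphic_on ball 0 1 \<and>
        (\<forall>z. norm z < 1 \<longrightarrow> norm (F z) < 1) \<and> F \<xi> = w \<and>
        (\<forall>z. norm z < 1 \<longrightarrow> F z = h z + (\<Prod>s\<leftarrow>ss. z - s) * k z))"
    using Cons.IH[OF h(1,2) \<rho>'(2) _ r1(2)] Cons.prems(4) by force
  obtain R2 where R2: "R2 < 1" "\<And>\<xi>. R2 < norm \<xi> \<Longrightarrow> norm \<xi> < 1 \<Longrightarrow> \<rho>' / r1 < norm (mob s \<xi>)"
    using mob_near_boundary[OF s, of "\<rho>' / r1"] r1 by (auto simp: divide_simps)
  show ?case
  proof (intro exI[of _ "max R1 R2"] conjI allI impI)
    show "max R1 R2 < 1" using R1 R2 by simp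
    fix \<xi> w :: complex assume \<xi>: "max R1 R2 < norm \<xi>" "norm \<xi> < 1" and w: "norm w \<le> r"
    have lb: "\<rho>' / r1 < norm (mob s \<xi>)" using R2 \<xi> by simp
    then have nz: "mob s \<xi> \<noteq> 0" using \<rho>'(1) r1(1) by (metis divide_nonneg_pos norm_zero not_less)
    have w1: "norm w < 1" using w Cons.prems(5) by linarith
    have "norm (mob c w / mob s \<xi>) \<le> r1"
    proof -
      have "norm (mob c w) \<le> \<rho>'" using \<rho>'(3)[of w] w by simp
      also have "\<dots> \<le> r1 * norm (mob s \<xi>)" using lb r1 by (simp add: field_simps)
      finally show ?thesis using nz by (simp add: norm_divide divide_simps mult.commute)
    qed
    then obtain F k where F: "F holomorphic_on ball 0 1" "k holomorphic_on ball 0 1"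
        "\<And>z. norm z < 1 \<Longrightarrow> norm (F z) < 1" "F \<xi> = mob c w / mob s \<xi>"
        "\<And>z. norm z < 1 \<Longrightarrow> F z = h z + (\<Prod>s\<leftarrow>ss. z - s) * k z"
      using IH[of \<xi> "mob c w / mob s \<xi>"] \<xi> by auto
    have less: "norm (mob s z * F z) < 1" if "norm z < 1" for z
      using norm_mult_less[of "mob s z" 1 "F z" 1] Moebius_function_norm_lt_1[OF s that] F(3)[OF that] by simp
    have less': "norm (mob s z * h z) < 1" if "norm z < 1" for z
      using h(3)[OF that] Moebius_function_norm_lt_1[OF c f1[OF that]] by metis
    have c': "norm (- c) < 1" using c by simp
    have holsF: "(\<lambda>z. mob s z * F z) holomorphic_on ball 0 1"
      by (intro holomorphic_intros F Moebius_function_holomorphic s)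
    have holsh: "(\<lambda>z. mob s z * h z) holomorphic_on ball 0 1"
      by (intro holomorphic_intros h Moebius_function_holomorphic s)
    \<comment> \<open>The cofactor collects what \<open>mob_diff\<close> contributes for
      \<open>mob (-c)\<close> and the denominator of \<open>mob s z\<close>, leaving the bare factor
      \<open>z - s\<close> in front.\<close>
    define K where "K z = k z / (1 - cnj s * z) * ((1 - cnj c * c) /
        ((1 + cnj c * (mob s z * F z)) * (1 + cnj c * (mob s z * h z))))" for z
    show "\<exists>F k. F holomorphic_on ball 0 1 \<and> k holomorphic_on ball 0 1 \<and>
        (\<forall>z. norm z < 1 \<longrightarrow> norm (F z) < 1) \<and> F \<xi> = w \<and>
        (\<forall>z. norm z < 1 \<longrightarrow> F z = f z + (\<Prod>s\<leftarrow>s # ss. z - s) * k z)"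
    proof (rule exI[of _ "\<lambda>z. mob (-c) (mob s z * F z)"], rule exI[of _ K], intro conjI allI impI)
      show "(\<lambda>z. mob (-c) (mob s z * F z)) holomorphic_on ball 0 1"
        by (rule mob_comp_holomorphic[OF holsF]) (use less c' in auto)
      show "K holomorphic_on ball 0 1"
        unfolding K_def
      proof (intro holomorphic_intros F(1,2) h(1) Moebius_function_holomorphic s)
        fix z :: complex assume "z \<in> ball 0 1"
        then have z: "norm z < 1" by simp
        show "1 - cnj s * z \<noteq> 0" using mob_denom_nonzero[OF s z] .
        show "(1 + cnj c * (mob s z * F z)) * (1 + cnj c * (mob s z * h z)) \<noteq> 0"
          using mob_denom_nonzero[OF c' less[OF z]] mob_denom_nonzero[OF c' less'[OF z]] by simp
      qed
      show "mob (- c) (mob s \<xi> * F \<xi>) = w"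
        using nz mob_inverse(1)[OF c w1] by (simp add: F(4))
      fix z :: complex assume z: "norm z < 1"
      show "norm (mob (-c) (mob s z * F z)) < 1"
        using Moebius_function_norm_lt_1[OF c' less[OF z]] .
      have "mob (-c) (mob s z * F z) - f z = mob (-c) (mob s z * F z) - mob (-c) (mob s z * h z)"
        using mob_inverse(1)[OF c f1[OF z]] h(3)[OF z] by simp
      also have "\<dots> = (mob s z * F z - mob s z * h z) *
          ((1 - cnj c * c) / ((1 + cnj c * (mob s z * F z)) * (1 + cnj c * (mob s z * h z))))"
        using mob_diff[OF c' less[OF z] less'[OF z]] by simp
      also have "mob s z * F z - mob s z * h z = (\<Prod>s\<leftarrow>s # ss. z - s) * (k z / (1 - cnj s * z))"
        unfolding right_diff_distrib[symmetric] by (simp add: F(5)[OF z] Moebius_function_simple)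
      finally have "mob (-c) (mob s z * F z) - f z = (\<Prod>s\<leftarrow>s # ss. z - s) * K z"
        unfolding K_def by (simp only: mult.assoc)
      then show "mob (-c) (mob s z * F z) = f z + (\<Prod>s\<leftarrow>s # ss. z - s) * K z"
        by (simp only: diff_eq_eq add.commute)
    qed
  qed
qed

subsection \<open>Competitors\<close>

lemma norm_mob_commute:
  assumes "norm w < 1" "norm z < 1"
  shows "norm (mob w z) = norm (mob z w)"
proof -
  have "norm (1 - cnj w * z) = norm (1 - cnj z * w)"
    by (metis complex_cnj_cnj complex_cnj_diff complex_cnj_mult complex_cnj_one complex_mod_cnj mult.commute)
  then show ?thesis
    by (simp add: Moebius_function_simple norm_divide norm_minus_commute)
qed

section \<open>Self-maps of the disc\<close>

text \<open>A map into the bidisc is a pair of such functions with no condition linking them, so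
  competitors are built one coordinate at a time and only the nodes are shared.\<close>

definition self_map :: "(complex \<Rightarrow> complex) \<Rightarrow> bool" where
  "self_map f \<longleftrightarrow> f holomorphic_on ball 0 1 \<and> (\<forall>z. norm z < 1 \<longrightarrow> norm (f z) < 1)"

lemma disc_to_bidisc_iff: "disc_to_bidisc f g \<longleftrightarrow> self_map f \<and> self_map g"
  by (auto simp: disc_to_bidisc_def self_map_def image_subset_iff)

lemma self_mapD:
  assumes "self_map f"
  shows "f holomorphic_on ball 0 1" "\<And>z. norm z < 1 \<Longrightarrow> norm (f z) < 1"
  using assms by (auto simp: self_map_def)

lemma self_map_mob: "norm w < 1 \<Longrightarrow> self_map (mob w)"
  by (simp add: self_map_def Moebius_function_holomorphic Moebius_function_norm_lt_1)

lemma self_map_mob_comp: "self_map f \<Longrightarrow> norm w < 1 \<Longrightarrow> self_map (\<lambda>z. mob w (f z))"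
  unfolding self_map_def by (auto intro!: mob_comp_holomorphic simp: Moebius_function_norm_lt_1)

lemma self_map_mult:
  assumes "self_map f" "g holomorphic_on ball 0 1" "\<And>z. norm z < 1 \<Longrightarrow> norm (g z) \<le> 1"
  shows "self_map (\<lambda>z. f z * g z)"
proof -
  have "norm (f z * g z) < 1" if "norm z < 1" for z
  proof -
    have "norm (f z) * norm (g z) \<le> norm (f z) * 1"
      by (rule mult_left_mono) (use assms(3) that in auto)
    also have "\<dots> < 1" using self_mapD(2)[OF assms(1) that] by simp
    finally show ?thesis by (simp add: norm_mult)
  qed
  then show ?thesis
    using assms(1,2) by (auto simp: self_map_def intro!: holomorphic_intros)
qed

text \<open>Contracting the variable pushes the image into a disc of radius
  \<open>\<rho> < 1\<close>, which leaves room for later changes. The price is that nodes move from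
  \<open>x\<close> to \<open>x / k\<close>.\<close>

lemma self_map_scale:
  assumes "self_map f" "norm k < 1"
  obtains \<rho> where "(\<lambda>z. f (k * z)) holomorphic_on ball 0 1"
    "\<And>z. norm z < 1 \<Longrightarrow> norm (f (k * z)) \<le> \<rho>" "0 \<le> \<rho>" "\<rho> < 1"
proof -
  have le: "norm (k * z) \<le> norm k" if "norm z < 1" for z
    using mult_left_mono[of "norm z" 1 "norm k"] that by (simp add: norm_mult)
  have "(\<lambda>z. f (k * z)) holomorphic_on ball 0 1"
    using holomorphic_on_compose_gen[of "\<lambda>z. k * z" "ball 0 1" f "ball 0 1"] self_mapD[OF assms(1)] le assms(2)
    by (force simp: o_def intro!: holomorphic_intros)
  moreover obtain \<rho> where "0 \<le> \<rho>" "\<rho> < 1" "\<And>z. norm z \<le> norm k \<Longrightarrow> norm (f z) \<le> \<rho>"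
    using disc_map_bounded_on_smaller_disc[OF self_mapD[OF assms(1)] assms(2)] by blast
  ultimately show thesis using that le by blast
qed

lemma self_map_add_node:
  assumes "f holomorphic_on ball 0 1" "\<And>z. norm z < 1 \<Longrightarrow> norm (f z) \<le> \<rho>" "\<rho> < 1"
    "\<And>s. s \<in> set ss \<Longrightarrow> norm s < 1" "norm w < 1"
  obtains R where "R < 1" "\<And>\<xi>. R < norm \<xi> \<Longrightarrow> norm \<xi> < 1 \<Longrightarrow>
     \<exists>F k. self_map F \<and> k holomorphic_on ball 0 1 \<and> F \<xi> = w \<and>
        (\<forall>z. norm z < 1 \<longrightarrow> F z = f z + (\<Prod>s\<leftarrow>ss. z - s) * k z)"
proof -
  have "\<exists>R<1. \<forall>\<xi> w'. R < norm \<xi> \<longrightarrow> norm \<xi> < 1 \<longrightarrow> norm w' \<le> norm w \<longrightarrow>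
     (\<exists>F k. F holomorphic_on ball 0 1 \<and> k holomorphic_on ball 0 1 \<and>
        (\<forall>z. norm z < 1 \<longrightarrow> norm (F z) < 1) \<and> F \<xi> = w' \<and>
        (\<forall>z. norm z < 1 \<longrightarrow> F z = f z + (\<Prod>s\<leftarrow>ss. z - s) * k z))"
    by (rule add_node[OF assms(1) _ assms(3) _ assms(5)]) (use assms(2,4) in auto)
  then obtain R where "R < 1" and *: "\<forall>\<xi> w'. R < norm \<xi> \<longrightarrow> norm \<xi> < 1 \<longrightarrow> norm w' \<le> norm w \<longrightarrow>
     (\<exists>F k. F holomorphic_on ball 0 1 \<and> k holomorphic_on ball 0 1 \<and>
        (\<forall>z. norm z < 1 \<longrightarrow> norm (F z) < 1) \<and> F \<xi> = w' \<and>
        (\<forall>z. norm z < 1 \<longrightarrow> F z = f z + (\<Prod>s\<leftarrow>ss. z - s) * k z))"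
    by (elim exE conjE) (rule that)
  show thesis
  proof (rule that[OF \<open>R < 1\<close>])
    fix \<xi> :: complex assume \<xi>: "R < norm \<xi>" "norm \<xi> < 1"
    show "\<exists>F k. self_map F \<and> k holomorphic_on ball 0 1 \<and> F \<xi> = w \<and>
        (\<forall>z. norm z < 1 \<longrightarrow> F z = f z + (\<Prod>s\<leftarrow>ss. z - s) * k z)"
      using *[rule_format, OF \<xi> order_refl] unfolding self_map_def by (elim exE conjE) (intro exI conjI)
  qed
qed

section \<open>Sums of logarithms as products\<close>

lemma elog_mult: "0 \<le> x \<Longrightarrow> 0 \<le> y \<Longrightarrow> elog x + elog y = elog (x * y)"
  by (auto simp: elog_def ln_mult)

lemma elog_mono: "0 \<le> x \<Longrightarrow> x \<le> y \<Longrightarrow> elog x \<le> elog y"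
  by (auto simp: elog_def)

lemma elog_exp [simp]: "elog (exp y) = ereal y"
  by (simp add: elog_def)

lemma elog_less_ereal: "0 \<le> x \<Longrightarrow> elog x < ereal y \<Longrightarrow> x < exp y"
  by (metis elog_exp elog_mono exp_ge_zero not_le)

text \<open>A strict gap in the extended reals becomes a strict gap between moduli, also when
  \<open>elog x\<close> is \<open>-\<infinity>\<close>. This slack pays for nodes moved outwards by
  scaling.\<close>

lemma elog_less_imp_larger:
  assumes "0 \<le> x" "elog x < y"
  obtains Y where "x < Y" "elog Y < y"
proof -
  obtain t where "elog x < ereal t" "ereal t < y"
    using assms(2) ereal_dense2 by blast
  then show thesis
    using that[of "exp t"] elog_less_ereal[OF assms(1)] by simp
qed

lemma two_elog: "0 \<le> x \<Longrightarrow> 2 * elog x = elog (x^2)"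
  by (auto simp: elog_def ln_realpow)

section \<open>Single competitors and the infima\<close>

lemma coman_lempert_two_le:
  assumes "self_map f" "self_map g" "(f 0, g 0) = z" "norm x1 < 1" "norm x2 < 1"
    "(f x1, g x1) = p" "(f x2, g x2) = q"
  shows "coman_lempert [p, q] z \<le> elog (norm x1 * norm x2)"
  unfolding coman_lempert_def
proof (rule Inf_lower, rule CollectI)
  show "\<exists>f g \<zeta>. elog (norm x1 * norm x2) = (\<Sum>j<length [p, q]. elog (norm (\<zeta> j))) \<and>
      disc_to_bidisc f g \<and> (f 0, g 0) = z \<and>
      (\<forall>j<length [p, q]. \<zeta> j \<in> ball 0 1 \<and> (f (\<zeta> j), g (\<zeta> j)) = [p, q] ! j)"
    by (rule exI[of _ f], rule exI[of _ g], rule exI[of _ "\<lambda>j. [x1, x2] ! j"])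
       (use assms in \<open>auto simp: elog_mult disc_to_bidisc_iff less_Suc_eq\<close>)
qed

lemma coman_lempert_twoE:
  assumes "coman_lempert [p, q] z < y"
  obtains f g x1 x2 where "self_map f" "self_map g" "(f 0, g 0) = z" "norm x1 < 1" "norm x2 < 1"
    "(f x1, g x1) = p" "(f x2, g x2) = q" "elog (norm x1 * norm x2) < y"
proof -
  obtain f g \<zeta> where *: "(\<Sum>j<length [p, q]. elog (norm (\<zeta> j))) < y" "disc_to_bidisc f g"
      "(f 0, g 0) = z" "\<forall>j<length [p, q]. \<zeta> j \<in> ball 0 1 \<and> (f (\<zeta> j), g (\<zeta> j)) = [p, q] ! j"
    using assms unfolding coman_lempert_def Inf_less_iff by blast
  show thesis
    by (rule that[of f g "\<zeta> 0" "\<zeta> 1"])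
       (use * in \<open>auto simp: elog_mult disc_to_bidisc_iff All_less_Suc dest: spec[of _ 0] spec[of _ "Suc 0"]\<close>)
qed

lemma coman_lempert_three_le:
  assumes "self_map f" "self_map g" "(f 0, g 0) = z" "norm x1 < 1" "norm x2 < 1" "norm x3 < 1"
    "(f x1, g x1) = p" "(f x2, g x2) = q" "(f x3, g x3) = w"
  shows "coman_lempert [p, q, w] z \<le> elog (norm x1 * norm x2 * norm x3)"
  unfolding coman_lempert_def
proof (rule Inf_lower, rule CollectI)
  show "\<exists>f g \<zeta>. elog (norm x1 * norm x2 * norm x3) = (\<Sum>j<length [p, q, w]. elog (norm (\<zeta> j))) \<and>
      disc_to_bidisc f g \<and> (f 0, g 0) = z \<and>
      (\<forall>j<length [p, q, w]. \<zeta> j \<in> ball 0 1 \<and> (f (\<zeta> j), g (\<zeta> j)) = [p, q, w] ! j)"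
    by (rule exI[of _ f], rule exI[of _ g], rule exI[of _ "\<lambda>j. [x1, x2, x3] ! j"])
       (use assms in \<open>auto simp: elog_mult disc_to_bidisc_iff less_Suc_eq\<close>)
qed

lemma coman_lempert_threeE:
  assumes "coman_lempert [p, q, w] z < y"
  obtains f g x1 x2 x3 where "self_map f" "self_map g" "(f 0, g 0) = z"
    "norm x1 < 1" "norm x2 < 1" "norm x3 < 1"
    "(f x1, g x1) = p" "(f x2, g x2) = q" "(f x3, g x3) = w"
    "elog (norm x1 * norm x2 * norm x3) < y"
proof -
  obtain f g \<zeta> where *: "(\<Sum>j<length [p, q, w]. elog (norm (\<zeta> j))) < y" "disc_to_bidisc f g"
      "(f 0, g 0) = z"
      "\<forall>j<length [p, q, w]. \<zeta> j \<in> ball 0 1 \<and> (f (\<zeta> j), g (\<zeta> j)) = [p, q, w] ! j"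
    using assms unfolding coman_lempert_def Inf_less_iff by blast
  show thesis
    by (rule that[of f g "\<zeta> 0" "\<zeta> 1" "\<zeta> 2"])
       (use * in \<open>auto simp: elog_mult disc_to_bidisc_iff All_less_Suc numeral_2_eq_2\<close>)
qed

lemma elog_add_twice_elog: "elog (norm x) + 2 * elog (norm y) = elog (norm x * norm y ^ 2)"
  using elog_mult[of "norm x" "norm y ^ 2"] two_elog[of "norm y"] by simp

lemma L_a0bV_le:
  assumes "self_map f" "self_map g" "(f 0, g 0) = z" "norm x1 < 1" "norm x2 < 1"
    "(f x1, g x1) = (a, 0)" "(f x2, g x2) = (b, 0)" "deriv f x2 = 0"
  shows "L_a0bV a b z \<le> elog (norm x1 * norm x2 ^ 2)"
  unfolding L_a0bV_def elog_add_twice_elog disc_to_bidisc_iff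
  using assms by (intro Inf_lower CollectI exI[of _ f] exI[of _ g] exI[of _ x1] exI[of _ x2]) auto

lemma L_a0bVE:
  assumes "L_a0bV a b z < y"
  obtains f g x1 x2 where "self_map f" "self_map g" "(f 0, g 0) = z" "norm x1 < 1" "norm x2 < 1"
    "(f x1, g x1) = (a, 0)" "(f x2, g x2) = (b, 0)" "deriv f x2 = 0"
    "elog (norm x1 * norm x2 ^ 2) < y"
  using assms unfolding L_a0bV_def elog_add_twice_elog disc_to_bidisc_iff Inf_less_iff by auto

section \<open>Adding a pole\<close>

text \<open>By continuity every \<open>r\<close> close enough to 1 will do. Dividing two or three
  nodes by \<open>r\<close> divides the product of their moduli by \<open>r ^ 2\<close> or
  \<open>r ^ 3\<close>, hence the two powers.\<close>

lemma ex_scale: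
  fixes x y m Y :: real
  assumes "x < 1" "y < 1" "m < Y"
  obtains r where "0 < r" "r < 1" "x < r" "y < r" "m < Y * r ^ 3" "m < Y * r ^ 2"
proof -
  have t: "((\<lambda>r. Y * r ^ k) \<longlongrightarrow> Y * 1 ^ k) (at_left (1::real))" for k
    by (intro tendsto_intros)
  have i: "((\<lambda>r. r) \<longlongrightarrow> 1) (at_left (1::real))"
    by (rule tendsto_ident_at)
  have "eventually (\<lambda>r. r < 1) (at_left (1::real))"
    by (simp add: eventually_at_filter)
  moreover have "eventually (\<lambda>r. m < Y * r ^ k) (at_left (1::real))" for k
    using order_tendstoD(1)[OF t, of m k] assms(3) by simp
  moreover have "eventually (\<lambda>r. c < r) (at_left (1::real))" if "c < 1" for c
    using order_tendstoD(1)[OF i that] .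
  ultimately have "eventually (\<lambda>r. r < 1 \<and> 0 < r \<and> x < r \<and> y < r \<and> m < Y * r ^ 3 \<and> m < Y * r ^ 2) (at_left (1::real))"
    using assms by (intro eventually_conj) auto
  then show thesis
    using that eventually_happens' trivial_limit_at_left_real by blast
qed

text \<open>A node added near the boundary contributes a factor below 1. Only the initial scaling
  enlarges the product of moduli, by as little as desired.\<close>

lemma coman_lempert_add_pole_le:
  assumes w: "norm (fst w) < 1" "norm (snd w) < 1"
  shows "coman_lempert [p, q, w] z \<le> coman_lempert [p, q] z"
proof (rule ccontr)
  assume "\<not> ?thesis"
  then have "coman_lempert [p, q] z < coman_lempert [p, q, w] z" by simp
  then obtain f g x1 x2 where fg: "self_map f" "self_map g" "(f 0, g 0) = z" "norm x1 < 1" "norm x2 < 1"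
    "(f x1, g x1) = p" "(f x2, g x2) = q" "elog (norm x1 * norm x2) < coman_lempert [p, q, w] z"
    by (rule coman_lempert_twoE)
  then obtain Y where Y: "norm x1 * norm x2 < Y" "elog Y < coman_lempert [p, q, w] z"
    using elog_less_imp_larger by (metis mult_nonneg_nonneg norm_ge_zero)
  obtain r where r: "0 < r" "r < 1" "norm x1 < r" "norm x2 < r" "norm x1 * norm x2 < Y * r ^ 2"
    using ex_scale[OF fg(4,5) Y(1)] by blast
  \<comment> \<open>The origin is listed as a node so that the base point \<open>z\<close> is kept
    along with the two poles.\<close>
  define ss where "ss = [0, x1 / of_real r, x2 / of_real r]"
  have nr: "norm (of_real r :: complex) < 1" using r by simp
  have ss: "\<And>s. s \<in> set ss \<Longrightarrow> norm s < 1" using r by (auto simp: ss_def norm_divide)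
  obtain \<rho> where \<rho>: "(\<lambda>z. f (of_real r * z)) holomorphic_on ball 0 1"
    "\<And>z. norm z < 1 \<Longrightarrow> norm (f (of_real r * z)) \<le> \<rho>" "\<rho> < 1"
    using self_map_scale[OF fg(1) nr] by blast
  obtain \<rho>' where \<rho>': "(\<lambda>z. g (of_real r * z)) holomorphic_on ball 0 1"
    "\<And>z. norm z < 1 \<Longrightarrow> norm (g (of_real r * z)) \<le> \<rho>'" "\<rho>' < 1"
    using self_map_scale[OF fg(2) nr] by blast
  obtain R where R: "R < 1" "\<And>\<xi>. R < norm \<xi> \<Longrightarrow> norm \<xi> < 1 \<Longrightarrow>
     \<exists>F k. self_map F \<and> k holomorphic_on ball 0 1 \<and> F \<xi> = fst w \<and>
        (\<forall>z. norm z < 1 \<longrightarrow> F z = f (of_real r * z) + (\<Prod>s\<leftarrow>ss. z - s) * k z)"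
    using self_map_add_node[OF \<rho> ss w(1)] by metis
  obtain R' where R': "R' < 1" "\<And>\<xi>. R' < norm \<xi> \<Longrightarrow> norm \<xi> < 1 \<Longrightarrow>
     \<exists>F k. self_map F \<and> k holomorphic_on ball 0 1 \<and> F \<xi> = snd w \<and>
        (\<forall>z. norm z < 1 \<longrightarrow> F z = g (of_real r * z) + (\<Prod>s\<leftarrow>ss. z - s) * k z)"
    using self_map_add_node[OF \<rho>' ss w(2)] by metis
  obtain t where t: "max 0 (max R R') < t" "t < 1"
    using dense[of "max 0 (max R R')" 1] R R' by auto
  define \<xi> :: complex where "\<xi> = of_real t"
  have \<xi>: "R < norm \<xi>" "R' < norm \<xi>" "norm \<xi> < 1" using t by (auto simp: \<xi>_def)
  obtain F k where F: "self_map F" "F \<xi> = fst w"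
    "\<And>z. norm z < 1 \<Longrightarrow> F z = f (of_real r * z) + (\<Prod>s\<leftarrow>ss. z - s) * k z"
    using R(2)[OF \<xi>(1,3)] by blast
  obtain G l where G: "self_map G" "G \<xi> = snd w"
    "\<And>z. norm z < 1 \<Longrightarrow> G z = g (of_real r * z) + (\<Prod>s\<leftarrow>ss. z - s) * l z"
    using R'(2)[OF \<xi>(2,3)] by blast
  have n: "norm (x1 / of_real r) < 1" "norm (x2 / of_real r) < 1"
    using ss by (auto simp: ss_def)
  have "coman_lempert [p, q, w] z \<le> elog (norm (x1 / of_real r) * norm (x2 / of_real r) * norm \<xi>)"
    by (rule coman_lempert_three_le[OF F(1) G(1)])
       (use fg(3,6,7) F(2,3) G(2,3) n \<xi> r(1) in \<open>auto simp: ss_def\<close>)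
  also have "\<dots> \<le> elog Y"
  proof (rule elog_mono)
    have "norm (x1 / of_real r) * norm (x2 / of_real r) * norm \<xi>
        \<le> norm (x1 / of_real r) * norm (x2 / of_real r) * 1"
      by (rule mult_left_mono) (use \<xi> in auto)
    also have "\<dots> \<le> Y"
      using r by (simp add: norm_divide divide_simps power2_eq_square)
    finally show "norm (x1 / of_real r) * norm (x2 / of_real r) * norm \<xi> \<le> Y" .
  qed simp
  also have "\<dots> < coman_lempert [p, q, w] z" by fact
  finally show False by simp
qed

section \<open>An upper bound for the two-pole function\<close>

lemma ex_self_map_two_zeros:
  assumes "norm x1 < 1" "norm x2 < 1" "norm w \<le> norm x1 * norm x2"
  obtains g where "self_map g" "g 0 = w" "g x1 = 0" "g x2 = 0"
proof
  \<comment> \<open>If a node is 0, the hypothesis forces \<open>w = 0\<close>, and division by zero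
    makes the constant 0 as well.\<close>
  let ?c = "w / (x1 * x2)"
  have c: "norm ?c \<le> 1"
    using assms(3) by (cases "x1 * x2 = 0") (auto simp: norm_divide norm_mult divide_simps)
  have "norm (mob x2 z * ?c) \<le> 1" if "norm z < 1" for z
    using mult_mono[OF order.strict_implies_order[OF Moebius_function_norm_lt_1[OF assms(2) that]] c]
    unfolding norm_mult by simp
  then show "self_map (\<lambda>z. mob x1 z * (mob x2 z * ?c))"
    by (intro self_map_mult self_map_mob assms holomorphic_intros Moebius_function_holomorphic)
  show "mob x1 0 * (mob x2 0 * ?c) = w"
    using assms(3) by (auto simp: Moebius_function_of_zero)
qed (simp_all add: Moebius_function_eq_zero)

text \<open>A contracted automorphism passes through \<open>a\<close> at the point \<open>c\<close>;
  the contraction leaves room to take the value \<open>b\<close> at a further node near the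
  boundary.\<close>

lemma ex_self_map_through_two_aux:
  assumes "norm u < 1" "norm a < 1" "norm b < 1" "norm (mob u a) < c" "c < 1" "0 \<le> t" "t < c"
  obtains f x1 x2 where "self_map f" "f 0 = u" "norm x1 < 1" "norm x2 < 1" "f x1 = a" "f x2 = b"
    "t \<le> norm x1 * norm x2" "norm x1 * norm x2 \<le> c"
proof -
  have c0: "0 < c" using assms(6,7) by linarith
  \<comment> \<open>Chosen so that \<open>mob (-u) (k * z)\<close> is \<open>u\<close> at 0 and
    \<open>a\<close> at \<open>c\<close>.\<close>
  define k where "k = mob u a / of_real c"
  have k: "norm k < 1" using assms(4) c0 by (simp add: k_def norm_divide)
  have u': "norm (- u) < 1" using assms(1) by simp
  obtain \<rho> where \<rho>: "(\<lambda>z. mob (-u) (k * z)) holomorphic_on ball 0 1"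
    "\<And>z. norm z < 1 \<Longrightarrow> norm (mob (-u) (k * z)) \<le> \<rho>" "\<rho> < 1"
    using self_map_scale[OF self_map_mob[OF u'] k] by blast
  have ss: "\<And>s. s \<in> set [0, complex_of_real c] \<Longrightarrow> norm s < 1" using c0 assms(5) by auto
  obtain R where R: "R < 1" "\<And>\<xi>. R < norm \<xi> \<Longrightarrow> norm \<xi> < 1 \<Longrightarrow>
     \<exists>F l. self_map F \<and> l holomorphic_on ball 0 1 \<and> F \<xi> = b \<and>
        (\<forall>z. norm z < 1 \<longrightarrow> F z = mob (-u) (k * z) + (\<Prod>s\<leftarrow>[0, complex_of_real c]. z - s) * l z)"
    using self_map_add_node[OF \<rho> ss assms(3)] by metis
  \<comment> \<open>The bound \<open>t / c < s\<close> keeps the product \<open>c * s\<close> of the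
    nodes above \<open>t\<close>.\<close>
  obtain s where s: "max (t / c) R < s" "s < 1"
    using dense[of "max (t / c) R" 1] R assms c0 by (auto simp: divide_simps)
  have s0: "0 < s"
    using s(1) assms(6) c0 by (smt (verit) divide_nonneg_pos)
  have s1: "R < norm (complex_of_real s)" "norm (complex_of_real s) < 1" using s s0 by auto
  obtain F l where F: "self_map F" "F (of_real s) = b"
     "\<And>z. norm z < 1 \<Longrightarrow> F z = mob (-u) (k * z) + (\<Prod>s\<leftarrow>[0, complex_of_real c]. z - s) * l z"
    using R(2)[OF s1] by blast
  show thesis
  proof (rule that[of F "of_real c" "of_real s"])
    show "F 0 = u" using F(3)[of 0] by (simp add: Moebius_function_of_zero)
    have "F (of_real c) = mob (-u) (mob u a)"
      using F(3)[of "of_real c"] c0 assms(5) by (simp add: k_def)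
    then show "F (of_real c) = a" using mob_inverse(1)[OF assms(1,2)] by simp
    show "t \<le> norm (complex_of_real c) * norm (complex_of_real s)"
      using s c0 s0 by (simp add: divide_simps mult.commute)
    show "norm (complex_of_real c) * norm (complex_of_real s) \<le> c"
      using s c0 s0 by simp
    show "norm (complex_of_real c) < 1" using c0 assms(5) by simp
  qed (use F(1,2) s1 in simp_all)
qed

text \<open>If one of the two distances is below \<open>c\<close>, that point gets the node
  \<open>c\<close> and the other a node near the boundary. Otherwise a scaled automorphism passes
  through both. The lower bound \<open>t\<close> will leave room for the second coordinate.\<close>

lemma ex_self_map_through_two:
  assumes "norm u < 1" "norm a < 1" "norm b < 1" "norm (mob u a) * norm (mob u b) < c" "c < 1"
    "0 \<le> t" "t < c"
  obtains f x1 x2 where "self_map f" "f 0 = u" "norm x1 < 1" "norm x2 < 1" "f x1 = a" "f x2 = b"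
    "t \<le> norm x1 * norm x2" "norm x1 * norm x2 \<le> c"
proof -
  define A B where "A = mob u a" and "B = mob u b"
  have AB1: "norm A < 1" "norm B < 1"
    using assms(1-3) by (auto simp: A_def B_def Moebius_function_norm_lt_1)
  consider "norm A < c" | "norm B < c" | "c \<le> norm A" "c \<le> norm B" by linarith
  then show thesis
  proof cases
    case 1
    then show thesis
      using ex_self_map_through_two_aux[of u a b c t] assms that unfolding A_def by blast
  next
    case 2
    then obtain f x1 x2 where "self_map f" "f 0 = u" "norm x1 < 1" "norm x2 < 1" "f x1 = b" "f x2 = a"
      "t \<le> norm x1 * norm x2" "norm x1 * norm x2 \<le> c"
      using ex_self_map_through_two_aux[of u b a c t] assms unfolding B_def by blast
    then show thesis using that[of f x2 x1] by (simp add: mult.commute)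
  next
    case 3
    have c0: "0 < c" using assms(6,7) by linarith
    have pos: "0 < norm A" "0 < norm B" using c0 3 by auto
    \<comment> \<open>The nodes will be \<open>A / r\<close> and \<open>B / r\<close>; this
      \<open>r\<close> makes the product of their moduli equal to \<open>c\<close>.\<close>
    define r where "r = sqrt (norm A * norm B / c)"
    have r2: "r ^ 2 = norm A * norm B / c" using pos c0 by (simp add: r_def)
    have r0: "0 < r" using pos c0 by (simp add: r_def)
    have r1: "r < 1"
      using assms(4) c0 by (simp add: r_def A_def B_def)
    \<comment> \<open>After squaring, \<open>norm A < r\<close> amounts to
      \<open>norm A < norm B / c\<close>, which follows from \<open>norm A < 1\<close> and
      \<open>c \<le> norm B\<close>; likewise with the roles exchanged.\<close>
    have small: "norm x < r" if "norm x < 1" "norm x > 0" "c \<le> norm y" "norm A * norm B = norm x * norm y" for x y :: complex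
    proof -
      have "c * norm x < c" using that c0 by simp
      also have "c \<le> norm y" by fact
      finally have "norm x * (c * norm x) < norm x * norm y" using that by simp
      then have "norm x ^ 2 < norm A * norm B / c"
        using c0 that(4) by (simp add: power2_eq_square less_divide_eq algebra_simps)
      then have "norm x ^ 2 < r ^ 2"
        by (simp only: r2)
      then show ?thesis using r0 by (rule_tac power_less_imp_less_base) auto
    qed
    have Ar: "norm A < r" "norm B < r"
      using small[of A B] small[of B A] AB1 pos 3 by (auto simp: mult.commute)
    have u': "norm (- u) < 1" using assms(1) by simp
    have nr: "norm (complex_of_real r) < 1" using r0 r1 by simp
    obtain \<rho> where \<rho>: "(\<lambda>z. mob (-u) (of_real r * z)) holomorphic_on ball 0 1"
      "\<And>z. norm z < 1 \<Longrightarrow> norm (mob (-u) (of_real r * z)) \<le> \<rho>" "\<rho> < 1"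
      using self_map_scale[OF self_map_mob[OF u'] nr] by blast
    have prod: "norm (A / of_real r) * norm (B / of_real r) = c"
    proof -
      have "norm (A / of_real r) * norm (B / of_real r) = norm A * norm B / r ^ 2"
        using r0 by (simp add: norm_divide power2_eq_square)
      also have "\<dots> = c" using pos unfolding r2 by simp
      finally show ?thesis .
    qed
    show thesis
    proof (rule that[of "\<lambda>z. mob (-u) (of_real r * z)" "A / of_real r" "B / of_real r"])
      show "self_map (\<lambda>z. mob (-u) (of_real r * z))"
        unfolding self_map_def using \<rho> by (auto intro: order.strict_trans1)
      show "mob (-u) (of_real r * (A / of_real r)) = a" "mob (-u) (of_real r * (B / of_real r)) = b"
        using r0 mob_inverse(1)[OF assms(1,2)] mob_inverse(1)[OF assms(1,3)] by (auto simp: A_def B_def)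
      show "norm (A / of_real r) < 1" "norm (B / of_real r) < 1"
        using Ar r0 by (auto simp: norm_divide)
      show "t \<le> norm (A / of_real r) * norm (B / of_real r)"
        "norm (A / of_real r) * norm (B / of_real r) \<le> c"
        unfolding prod using assms(7) by auto
    qed (simp add: Moebius_function_of_zero)
  qed
qed

text \<open>The first coordinate is built with a product of nodes between
  \<open>norm (snd z)\<close> and \<open>c\<close>; the lower bound is what a second coordinate with
  zeros at the same nodes requires.\<close>

lemma coman_lempert_two_le_max:
  assumes "norm a < 1" "norm b < 1" "norm (fst z) < 1" "norm (snd z) < c" "c < 1"
    "norm (mob (fst z) a) * norm (mob (fst z) b) < c"
  shows "coman_lempert [(a, 0), (b, 0)] z \<le> elog c"
proof -
  obtain f x1 x2 where f: "self_map f" "f 0 = fst z" "norm x1 < 1" "norm x2 < 1" "f x1 = a" "f x2 = b"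
    "norm (snd z) \<le> norm x1 * norm x2" "norm x1 * norm x2 \<le> c"
    using ex_self_map_through_two[OF assms(3,1,2,6,5), of "norm (snd z)"] assms(4) by auto
  obtain g where g: "self_map g" "g 0 = snd z" "g x1 = 0" "g x2 = 0"
    using ex_self_map_two_zeros[OF f(3,4,7)] .
  have "coman_lempert [(a, 0), (b, 0)] z \<le> elog (norm x1 * norm x2)"
    by (rule coman_lempert_two_le[OF f(1) g(1)]) (use f g in auto)
  also have "\<dots> \<le> elog c" by (rule elog_mono) (use f in auto)
  finally show ?thesis .
qed

subsection \<open>The upper limit\<close>

text \<open>Expanding by \<open>x - v\<close> gives a quotient of two difference quotients. It
  measures which multiple of \<open>q\<close> corrects the value of a map near
  \<open>v\<close>.\<close>

lemma quotient_tendsto_of_derivatives: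
  fixes h q :: "complex \<Rightarrow> complex"
  assumes h: "(h has_field_derivative h') (at v)" and q: "(q has_field_derivative q') (at v)"
    and q': "q' \<noteq> 0" and qv: "q v = 0"
  shows "((\<lambda>x. (h x - h v) / q x) \<longlongrightarrow> h' / q') (at v)"
proof -
  have "((\<lambda>x. ((h x - h v) / (x - v)) / ((q x - q v) / (x - v))) \<longlongrightarrow> h' / q') (at v)"
    using h q q' by (intro tendsto_divide) (auto simp: has_field_derivative_iff)
  moreover have "eventually (\<lambda>x. ((h x - h v) / (x - v)) / ((q x - q v) / (x - v)) = (h x - h v) / q x) (at v)"
    by (auto simp: eventually_at_filter qv)
  ultimately show ?thesis
    by (rule Lim_transform_eventually)
qed

lemma norm_node_polynomial_le:
  fixes u v z :: complex
  assumes "norm u < 1" "norm v < 1" "norm z < 1"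
  shows "norm (z * (z - u) * (z - v)) \<le> 4"
proof -
  have "norm (z - u) \<le> 2" "norm (z - v) \<le> 2"
    using norm_triangle_ineq4[of z u] norm_triangle_ineq4[of z v] assms by linarith+
  then have "norm z * norm (z - u) * norm (z - v) \<le> 1 * 2 * 2"
    using assms by (intro mult_mono) auto
  then show ?thesis by (simp add: norm_mult)
qed

text \<open>The cubic vanishes at 0, \<open>u\<close> and \<open>v\<close>, so the values there
  survive; 4 is its bound on the disc.\<close>

lemma self_map_add_small:
  assumes "f holomorphic_on ball 0 1" "\<And>z. norm z < 1 \<Longrightarrow> norm (f z) \<le> \<rho>"
    "norm u < 1" "norm v < 1" "norm c * 4 < 1 - \<rho>"
  shows "self_map (\<lambda>z. f z + c * (z * (z - u) * (z - v)))"
  unfolding self_map_def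
proof (intro conjI allI impI)
  show "(\<lambda>z. f z + c * (z * (z - u) * (z - v))) holomorphic_on ball 0 1"
    by (intro holomorphic_intros assms(1))
  fix z :: complex assume z: "norm z < 1"
  have "norm (f z + c * (z * (z - u) * (z - v))) \<le> norm (f z) + norm c * norm (z * (z - u) * (z - v))"
    by (metis norm_mult norm_triangle_ineq)
  also have "\<dots> \<le> \<rho> + norm c * 4"
    using assms z by (intro add_mono mult_left_mono norm_node_polynomial_le) auto
  finally show "norm (f z + c * (z * (z - u) * (z - v))) < 1" using assms(5) by linarith
qed

lemma deriv_scaled:
  assumes "f holomorphic_on ball 0 1" "norm x < 1" "r \<noteq> 0"
  shows "((\<lambda>z. f (r * z)) has_field_derivative deriv f x * r) (at (x / r))"
proof -
  have "(f has_field_derivative deriv f x) (at (r * (x / r)))"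
    using assms holomorphic_derivI[of f "ball 0 1" x] by simp
  moreover have "((\<lambda>z. r * z) has_field_derivative r) (at (x / r))"
    by (auto intro!: derivative_eq_intros)
  ultimately show ?thesis by (rule DERIV_chain2)
qed

lemma eventually_norm_less_1: "eventually (\<lambda>\<epsilon>. norm \<epsilon> < 1) (at (0::complex))"
  using order_tendstoD(2)[OF tendsto_norm[OF tendsto_ident_at[of "0::complex" UNIV]], of 1] by simp

text \<open>A third node is placed near the double node, and both coordinates are corrected by
  multiples of a cubic vanishing at the points already fixed. The zero derivative makes the
  correction of the first coordinate small; a nonzero derivative lets the second one reach
  \<open>\<epsilon>\<close>.\<close>

lemma coman_lempert_three_eventually_less:
  assumes a: "norm a < 1" and b: "norm b < 1" and ab: "a \<noteq> b" and y: "L_a0bV a b z < y"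
  shows "eventually (\<lambda>\<epsilon>. coman_lempert [(a,0), (b,0), (b,\<epsilon>)] z < y) (at 0)"
proof -
  obtain f g x1 x2 where fg: "self_map f" "self_map g" "(f 0, g 0) = z" "norm x1 < 1" "norm x2 < 1"
    "(f x1, g x1) = (a, 0)" "(f x2, g x2) = (b, 0)" "deriv f x2 = 0"
    "elog (norm x1 * norm x2 ^ 2) < y"
    using L_a0bVE[OF y] by blast
  show ?thesis
  proof (cases "x1 = 0 \<or> x2 = 0")
    \<comment> \<open>The same maps, as a competitor for the two poles, already have product 0, and
      adding a pole does not raise the infimum.\<close>
    case True
    have "eventually (\<lambda>\<epsilon>. norm \<epsilon> < 1) (at (0::complex))"
      by (rule eventually_norm_less_1)
    then show ?thesis
    proof eventually_elim
      case (elim \<epsilon>)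
      have "coman_lempert [(a,0), (b,0), (b,\<epsilon>)] z \<le> coman_lempert [(a,0), (b,0)] z"
        by (rule coman_lempert_add_pole_le) (use elim b in auto)
      also have "\<dots> \<le> elog (norm x1 * norm x2)"
        by (rule coman_lempert_two_le[OF fg(1-7)])
      also have "norm x1 * norm x2 = norm x1 * norm x2 ^ 2" using True by auto
      finally show ?case using fg(9) by simp
    qed
  next
    case False
    obtain Y where Y: "norm x1 * norm x2 ^ 2 < Y" "elog Y < y"
      using elog_less_imp_larger[OF _ fg(9)] by auto
    obtain r where r: "0 < r" "r < 1" "norm x1 < r" "norm x2 < r" "norm x1 * norm x2 ^ 2 < Y * r ^ 3"
      using ex_scale[OF fg(4,5) Y(1)] by blast
    define R where "R = complex_of_real r"
    have R: "R \<noteq> 0" "norm R < 1" using r by (auto simp: R_def)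
    define u v where "u = x1 / R" and "v = x2 / R"
    define f1 g0 where "f1 = (\<lambda>z. f (R * z))" and "g0 = (\<lambda>z. g (R * z))"
    have uv: "norm u < 1" "norm v < 1" "u \<noteq> 0" "v \<noteq> 0" "u \<noteq> v"
      using r False R fg(6,7) ab by (auto simp: u_def v_def R_def norm_divide)
    have vals: "f1 0 = fst z" "g0 0 = snd z" "f1 u = a" "g0 u = 0" "f1 v = b" "g0 v = 0"
      using fg(3,6,7) R by (auto simp: f1_def g0_def u_def v_def)
    obtain \<rho> where \<rho>: "f1 holomorphic_on ball 0 1" "\<And>z. norm z < 1 \<Longrightarrow> norm (f1 z) \<le> \<rho>" "\<rho> < 1"
      using self_map_scale[OF fg(1) R(2)] unfolding f1_def by blast
    obtain \<rho>' where \<rho>': "g0 holomorphic_on ball 0 1" "\<And>z. norm z < 1 \<Longrightarrow> norm (g0 z) \<le> \<rho>'" "\<rho>' < 1"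
      using self_map_scale[OF fg(2) R(2)] unfolding g0_def by blast
    define q where "q = (\<lambda>z. z * (z - u) * (z - v))"
    have q0: "q 0 = 0" "q u = 0" "q v = 0" by (auto simp: q_def)
    have dq: "(q has_field_derivative v * (v - u)) (at v)"
      unfolding q_def by (rule derivative_eq_intros refl)+ (simp add: algebra_simps)
    have q': "v * (v - u) \<noteq> 0" using uv by simp
    have df1: "(f1 has_field_derivative 0) (at v)"
      using deriv_scaled[OF self_mapD(1)[OF fg(1)] fg(5) R(1)] fg(8) unfolding f1_def v_def by simp
    have dg0: "(g0 has_field_derivative deriv g0 v) (at v)"
      using \<rho>'(1) uv(2) by (auto intro: holomorphic_derivI)
    \<comment> \<open>A tiny multiple of \<open>q\<close> makes the derivative of the second coordinate at \<open>v\<close> nonzero.\<close>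
    define \<eta> where "\<eta> = (if deriv g0 v = 0 then complex_of_real ((1 - \<rho>') / 8) else 0)"
    define g1 where "g1 = (\<lambda>z. g0 z + \<eta> * q z)"
    define \<gamma> where "\<gamma> = deriv g0 v + \<eta> * (v * (v - u))"
    have \<gamma>: "\<gamma> \<noteq> 0" using q' \<rho>'(3) by (auto simp: \<gamma>_def \<eta>_def)
    have dg1: "(g1 has_field_derivative \<gamma>) (at v)"
      unfolding g1_def \<gamma>_def by (intro DERIV_add dg0 DERIV_cmult dq)
    \<comment> \<open>Since \<open>norm \<eta>\<close> is at most \<open>(1 - \<rho>') / 8\<close>
      and \<open>q\<close> is bounded by 4, the change costs at most half of the gap
      \<open>1 - \<rho>'\<close>.\<close>
    define \<rho>1 where "\<rho>1 = (1 + \<rho>') / 2"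
    have \<rho>1: "g1 holomorphic_on ball 0 1" "\<rho>1 < 1"
      unfolding g1_def q_def using \<rho>' by (auto simp: \<rho>1_def intro!: holomorphic_intros)
    have g1b: "norm (g1 z) \<le> \<rho>1" if "norm z < 1" for z
    proof -
      have "norm (complex_of_real ((1 - \<rho>') / 8)) = (1 - \<rho>') / 8"
        unfolding norm_of_real using \<rho>'(3) by simp
      then have "norm \<eta> \<le> (1 - \<rho>') / 8" using \<rho>'(3) by (simp only: \<eta>_def split: if_split) simp
      then have "norm \<eta> * norm (q z) \<le> (1 - \<rho>') / 8 * 4"
        unfolding q_def using norm_node_polynomial_le[OF uv(1,2) that] \<rho>'(3) by (intro mult_mono) auto
      moreover have "norm (g1 z) \<le> norm (g0 z) + norm \<eta> * norm (q z)"
        unfolding g1_def by (metis norm_mult norm_triangle_ineq)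
      ultimately show ?thesis using \<rho>'(2)[OF that] by (simp add: \<rho>1_def field_simps)
    qed
    \<comment> \<open>To first order \<open>g1\<close> takes the value \<open>\<epsilon>\<close> at
      this point, since \<open>g1 v = 0\<close> and \<open>\<gamma>\<close> is its derivative at
      \<open>v\<close>.\<close>
    define X where "X = (\<lambda>\<epsilon>. v + \<epsilon> / \<gamma>)"
    have Xlim: "(X \<longlongrightarrow> v) (at 0)"
      unfolding X_def using \<gamma> by (auto intro!: tendsto_eq_intros)
    have Xne: "eventually (\<lambda>\<epsilon>. X \<epsilon> \<noteq> v) (at 0)"
      using \<gamma> by (auto simp: X_def eventually_at_filter)
    have X: "filterlim X (at v) (at 0)"
      using Xlim Xne by (simp add: filterlim_at)
    \<comment> \<open>The coefficients of \<open>q\<close> that make the corrected coordinates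
      exactly \<open>b\<close> and \<open>\<epsilon>\<close> at \<open>X \<epsilon>\<close>.\<close>
    define cf where "cf = (\<lambda>\<epsilon>. (b - f1 (X \<epsilon>)) / q (X \<epsilon>))"
    define cg where "cg = (\<lambda>\<epsilon>. (\<epsilon> - g1 (X \<epsilon>)) / q (X \<epsilon>))"
    \<comment> \<open>The numerator vanishes to second order at \<open>v\<close>, the denominator
      only to first order.\<close>
    have "((\<lambda>x. (f1 x - f1 v) / q x) \<longlongrightarrow> 0 / (v * (v - u))) (at v)"
      by (rule quotient_tendsto_of_derivatives[OF df1 dq q' q0(3)])
    from filterlim_compose[OF this X] have "(cf \<longlongrightarrow> - 0) (at 0)"
      unfolding cf_def using tendsto_minus by (fastforce simp: vals minus_divide_left)
    then have cf: "eventually (\<lambda>\<epsilon>. norm (cf \<epsilon>) < (1 - \<rho>) / 4) (at 0)"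
      using order_tendstoD(2)[OF tendsto_norm_zero, of cf "at 0" "(1 - \<rho>) / 4"] \<rho>(3) by simp
    \<comment> \<open>At \<open>x = X \<epsilon>\<close> the linear term is
      \<open>\<epsilon>\<close>, so this function becomes the numerator of
      \<open>cg\<close>.\<close>
    have "((\<lambda>x. \<gamma> * (x - v) - g1 x) has_field_derivative 0) (at v)"
      by (rule derivative_eq_intros dg1 refl)+ simp
    from quotient_tendsto_of_derivatives[OF this dq q' q0(3)]
    have "((\<lambda>x. (\<gamma> * (x - v) - g1 x) / q x) \<longlongrightarrow> 0) (at v)"
      by (simp add: g1_def vals q0)
    from filterlim_compose[OF this X] have "(cg \<longlongrightarrow> 0) (at 0)"
      unfolding cg_def using \<gamma> by (simp add: X_def)
    then have cg: "eventually (\<lambda>\<epsilon>. norm (cg \<epsilon>) < (1 - \<rho>1) / 4) (at 0)"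
      using order_tendstoD(2)[OF tendsto_norm_zero, of cg "at 0" "(1 - \<rho>1) / 4"] \<rho>1(2) by simp
    have X1: "eventually (\<lambda>\<epsilon>. norm (X \<epsilon>) < 1) (at 0)"
      using order_tendstoD(2)[OF tendsto_norm[OF Xlim] uv(2)] .
    have Xu: "eventually (\<lambda>\<epsilon>. X \<epsilon> \<noteq> u) (at 0)" "eventually (\<lambda>\<epsilon>. X \<epsilon> \<noteq> 0) (at 0)"
      using tendsto_imp_eventually_ne[OF Xlim] uv by auto
    have "norm u * norm v * norm v < Y"
      using r by (simp add: u_def v_def R_def norm_divide field_simps power2_eq_square power3_eq_cube)
    then have XY: "eventually (\<lambda>\<epsilon>. norm u * norm v * norm (X \<epsilon>) < Y) (at 0)"
      by (intro order_tendstoD(2)[where y = "norm u * norm v * norm v"] tendsto_intros Xlim)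
    show ?thesis
      using cf cg X1 Xu XY Xne
    proof eventually_elim
      case (elim \<epsilon>)
      have qX: "q (X \<epsilon>) \<noteq> 0" using elim by (simp add: q_def)
      have "coman_lempert [(a,0), (b,0), (b,\<epsilon>)] z \<le> elog (norm u * norm v * norm (X \<epsilon>))"
      proof (rule coman_lempert_three_le)
        show "self_map (\<lambda>z. f1 z + cf \<epsilon> * q z)"
          unfolding q_def by (rule self_map_add_small[OF \<rho>(1,2) uv(1,2)]) (use elim in auto)
        show "self_map (\<lambda>z. g1 z + cg \<epsilon> * q z)"
          unfolding q_def by (rule self_map_add_small[OF \<rho>1(1) g1b uv(1,2)]) (use elim in auto)
        show "(f1 (X \<epsilon>) + cf \<epsilon> * q (X \<epsilon>), g1 (X \<epsilon>) + cg \<epsilon> * q (X \<epsilon>)) = (b, \<epsilon>)"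
          using qX by (simp add: cf_def cg_def)
      qed (use uv elim in \<open>auto simp: vals q0 g1_def\<close>)
      also have "\<dots> \<le> elog Y"
        using elim by (intro elog_mono) auto
      finally show ?case using Y(2) by simp
    qed
  qed
qed

subsection \<open>The lower limit\<close>

lemma Schwarz_factor_two:
  assumes "f holomorphic_on ball 0 1" "\<And>z. norm z < 1 \<Longrightarrow> norm (f z) \<le> M"
    and "norm s < 1" "norm t < 1" "s \<noteq> t" "f s = 0" "f t = 0"
  obtains h where "h holomorphic_on ball 0 1" "\<And>z. norm z < 1 \<Longrightarrow> norm (h z) \<le> M"
    "\<And>z. norm z < 1 \<Longrightarrow> f z = mob s z * mob t z * h z"
proof -
  obtain h1 where h1: "h1 holomorphic_on ball 0 1" "\<And>z. norm z < 1 \<Longrightarrow> norm (h1 z) \<le> M"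
    "\<And>z. norm z < 1 \<Longrightarrow> f z = mob s z * h1 z"
    using Schwarz_factor[OF assms(1,2,3,6)] by blast
  have "h1 t = 0"
    using h1(3)[OF assms(4)] assms mob_eq_0_iff[of s t] by auto
  then obtain h where "h holomorphic_on ball 0 1" "\<And>z. norm z < 1 \<Longrightarrow> norm (h z) \<le> M"
    "\<And>z. norm z < 1 \<Longrightarrow> h1 z = mob t z * h z"
    using Schwarz_factor[OF h1(1,2) assms(4)] by blast
  then show thesis using that h1(3) by (simp add: mult.assoc)
qed

text \<open>The map \<open>mob (f s) (f z)\<close> vanishes at \<open>z = s\<close>, so the factor
  \<open>mob s z\<close> splits off; this is Schwarz-Pick in pseudohyperbolic form.\<close>

lemma Schwarz_Pick_mob:
  assumes f: "self_map f" and s: "norm s < 1" and z: "norm z < 1"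
  shows "norm (mob (f s) (f z)) \<le> norm (mob s z)"
proof -
  have fs: "norm (f s) < 1" using self_mapD(2)[OF f s] .
  have F: "self_map (\<lambda>z. mob (f s) (f z))"
    by (rule self_map_mob_comp[OF f fs])
  obtain h where h: "\<And>z. norm z < 1 \<Longrightarrow> norm (h z) \<le> 1"
    "\<And>z. norm z < 1 \<Longrightarrow> mob (f s) (f z) = mob s z * h z"
    by (rule Schwarz_factor[OF self_mapD(1)[OF F] _ s, of 1])
       (use self_mapD(2)[OF F] in \<open>auto simp: Moebius_function_eq_zero intro: less_imp_le\<close>)
  show ?thesis
    unfolding h(2)[OF z] norm_mult using h(1)[OF z] by (simp add: mult_left_le)
qed

text \<open>A stable form of the Schwarz bound \<open>norm s\<close> for a value \<open>h s\<close>
  that is only nearly 0: \<open>h - h s\<close> vanishes at \<open>s\<close> and is bounded by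
  \<open>1 + norm (h s)\<close>.\<close>

lemma Schwarz_at_0_approx:
  assumes "h holomorphic_on ball 0 1" "\<And>z. norm z < 1 \<Longrightarrow> norm (h z) \<le> 1" "norm s < 1"
  shows "norm (h 0) \<le> norm s + 2 * norm (h s)"
proof -
  have "norm (h z - h s) \<le> 1 + norm (h s)" if "norm z < 1" for z
    using norm_triangle_ineq4[of "h z" "h s"] assms(2)[OF that] by linarith
  then obtain k where k: "\<And>z. norm z < 1 \<Longrightarrow> norm (k z) \<le> 1 + norm (h s)"
    "\<And>z. norm z < 1 \<Longrightarrow> h z - h s = mob s z * k z"
    by (rule_tac Schwarz_factor[of "\<lambda>z. h z - h s" "1 + norm (h s)" s])
       (use assms in \<open>auto intro!: holomorphic_intros\<close>)
  have "norm (h 0) \<le> norm (h s) + norm (h 0 - h s)"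
    using norm_triangle_sub by blast
  also have "norm (h 0 - h s) = norm s * norm (k 0)"
    using k(2)[of 0] by (simp add: norm_mult)
  also have "\<dots> \<le> norm s * (1 + norm (h s))"
    using k(1)[of 0] by (simp add: mult_left_mono)
  also have "\<dots> \<le> norm s + norm (h s)"
    using assms(3) mult_right_mono[of "norm s" 1 "norm (h s)"] by (simp add: algebra_simps)
  finally show ?thesis by simp
qed

text \<open>Division by the two zeros leaves a quotient to which the approximate Schwarz bound
  applies at \<open>x3\<close>. The pseudohyperbolic factors stay on both sides, since the value of
  the quotient at \<open>x3\<close> is not controlled when \<open>x3\<close> is close to a
  zero.\<close>

lemma third_zero_estimate:
  assumes g: "self_map g" and x: "norm x1 < 1" "norm x2 < 1" "norm x3 < 1" "x1 \<noteq> x2"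
    and "g x1 = 0" "g x2 = 0"
  shows "norm (g 0) \<le> norm x1 * norm x2"
    and "norm (g 0) * (norm (mob x1 x3) * norm (mob x2 x3))
      \<le> norm x1 * norm x2 * norm x3 * (norm (mob x1 x3) * norm (mob x2 x3)) + 2 * norm (g x3)"
proof -
  obtain h where h: "h holomorphic_on ball 0 1" "\<And>z. norm z < 1 \<Longrightarrow> norm (h z) \<le> 1"
    "\<And>z. norm z < 1 \<Longrightarrow> g z = mob x1 z * mob x2 z * h z"
    by (rule Schwarz_factor_two[OF self_mapD(1)[OF g] _ x(1,2,4) assms(6,7), of 1])
       (use self_mapD(2)[OF g] in \<open>auto intro: less_imp_le\<close>)
  have g0: "norm (g 0) = norm x1 * norm x2 * norm (h 0)"
    using h(3)[of 0] by (simp add: norm_mult)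
  show "norm (g 0) \<le> norm x1 * norm x2"
    unfolding g0 using h(2)[of 0] by (simp add: mult_left_le)
  define m where "m = norm (mob x1 x3) * norm (mob x2 x3)"
  have m: "0 \<le> m" by (simp add: m_def)
  have gx3: "norm (g x3) = m * norm (h x3)"
    using h(3)[OF x(3)] by (simp add: norm_mult m_def)
  have p: "0 \<le> norm x1 * norm x2" "norm x1 * norm x2 \<le> 1"
    using x mult_le_one[of "norm x1" "norm x2"] by auto
  have "norm (g 0) * m \<le> norm x1 * norm x2 * (norm x3 + 2 * norm (h x3)) * m"
    unfolding g0 by (intro mult_right_mono mult_left_mono m p Schwarz_at_0_approx h x)
  also have "\<dots> = norm x1 * norm x2 * norm x3 * m + (norm x1 * norm x2) * (2 * norm (g x3))"
    unfolding gx3 by (simp add: algebra_simps)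
  also have "\<dots> \<le> norm x1 * norm x2 * norm x3 * m + 1 * (2 * norm (g x3))"
    by (intro add_left_mono mult_right_mono p) auto
  finally show "norm (g 0) * (norm (mob x1 x3) * norm (mob x2 x3))
      \<le> norm x1 * norm x2 * norm x3 * (norm (mob x1 x3) * norm (mob x2 x3)) + 2 * norm (g x3)"
    unfolding m_def by simp
qed

lemma norm_diff_le_mob:
  assumes "norm w < 1" "norm z < 1"
  shows "norm (z - w) \<le> 2 * norm (mob w z)"
proof -
  have "norm (cnj w * z) \<le> 1"
    using assms mult_le_one[of "norm w" "norm z"] by (simp add: norm_mult)
  then have "norm (1 - cnj w * z) \<le> 2"
    using norm_triangle_ineq4[of 1 "cnj w * z"] by simp
  moreover have "norm (z - w) = norm (mob w z) * norm (1 - cnj w * z)"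
    using mob_denom_nonzero[OF assms] by (simp add: Moebius_function_simple norm_divide)
  ultimately show ?thesis
    using mult_left_mono[of "norm (1 - cnj w * z)" 2 "norm (mob w z)"] by (simp add: mult.commute)
qed

section \<open>Competitors obtained as limits\<close>

text \<open>This serves the limit in which the node of \<open>a\<close> runs into the unit circle.
  After scaling, a node for \<open>a\<close> is put back near the boundary, and its factor below 1
  does not spoil the bound.\<close>

lemma L_a0bV_le_boundary:
  assumes f: "self_map f" "f 0 = fst z" "f x = b" "deriv f x = 0" "norm a < 1" "norm x < 1"
    and "0 < norm (snd z)" "norm (snd z) \<le> norm x" "norm x ^ 2 < Y"
  shows "L_a0bV a b z \<le> elog Y"
proof -
  obtain r where r: "0 < r" "r < 1" "norm x < r" "norm x ^ 2 < Y * r ^ 2"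
    using ex_scale[OF assms(6,6,9)] by blast
  define R where "R = complex_of_real r"
  have R: "R \<noteq> 0" "norm R < 1" using r by (auto simp: R_def)
  define v where "v = x / R"
  have v: "norm v < 1" "norm (snd z) < norm v" "norm v ^ 2 < Y"
  proof -
    have nv: "norm v = norm x / r" using r by (simp add: v_def R_def norm_divide)
    show "norm v < 1" "norm v ^ 2 < Y" using r by (simp_all add: nv field_simps)
    \<comment> \<open>Scaling moves the double node outwards and makes
      \<open>norm (snd z) < norm v\<close> strict, which leaves room for a node \<open>T\<close>
      with \<open>norm (snd z) \<le> norm T * norm v\<close>.\<close>
    have "norm x * r < norm x * 1" using r assms(7,8) by (intro mult_strict_left_mono) auto
    then have "norm x < norm v" using r by (simp add: nv field_simps)
    then show "norm (snd z) < norm v" using assms(8) by linarith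
  qed
  \<comment> \<open>Listing \<open>v\<close> twice preserves the derivative there as well as the
    value.\<close>
  have ss: "\<And>s. s \<in> set [0, v, v] \<Longrightarrow> norm s < 1" using v by auto
  obtain \<rho> where \<rho>: "(\<lambda>z. f (R * z)) holomorphic_on ball 0 1"
    "\<And>z. norm z < 1 \<Longrightarrow> norm (f (R * z)) \<le> \<rho>" "\<rho> < 1"
    using self_map_scale[OF f(1) R(2)] by blast
  obtain S where S: "S < 1" "\<And>\<xi>. S < norm \<xi> \<Longrightarrow> norm \<xi> < 1 \<Longrightarrow>
     \<exists>F k. self_map F \<and> k holomorphic_on ball 0 1 \<and> F \<xi> = a \<and>
        (\<forall>z. norm z < 1 \<longrightarrow> F z = f (R * z) + (\<Prod>s\<leftarrow>[0, v, v]. z - s) * k z)"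
    using self_map_add_node[OF \<rho> ss f(5)] by metis
  have "norm (snd z) / norm v < 1" using v(2) assms(7) by (simp add: divide_simps)
  then obtain t where t: "max S (norm (snd z) / norm v) < t" "t < 1"
    using dense[of "max S (norm (snd z) / norm v)" 1] S by auto
  have t0: "0 < t"
    using t(1) by (smt (verit) divide_nonneg_nonneg norm_ge_zero max.bounded_iff)
  define T where "T = complex_of_real t"
  have T: "S < norm T" "norm T < 1" "norm (snd z) \<le> norm T * norm v"
    using t t0 v(2) assms(7) by (auto simp: T_def divide_simps mult.commute split: if_splits)
  obtain F k where F: "self_map F" "k holomorphic_on ball 0 1" "F T = a"
    "\<And>z. norm z < 1 \<Longrightarrow> F z = f (R * z) + (\<Prod>s\<leftarrow>[0, v, v]. z - s) * k z"
    using S(2)[OF T(1,2)] by blast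
  obtain g where g: "self_map g" "g 0 = snd z" "g T = 0" "g v = 0"
    using ex_self_map_two_zeros[OF T(2) v(1) T(3)] .
  have dk: "(k has_field_derivative deriv k v) (at v)"
    using F(2) v(1) by (auto intro: holomorphic_derivI)
  have df: "((\<lambda>z. f (R * z)) has_field_derivative 0) (at v)"
    using deriv_scaled[OF self_mapD(1)[OF f(1)] f(6) R(1)] f(4) unfolding v_def by simp
  have "((\<lambda>z. f (R * z) + z * (z - v) * (z - v) * k z) has_field_derivative 0) (at v)"
    by (rule derivative_eq_intros df dk refl)+ simp
  then have "(F has_field_derivative 0) (at v)"
    by (rule has_field_derivative_transform_within_open[where S = "ball 0 1"])
       (use F(4) v in \<open>auto simp: mult.assoc\<close>)
  then have dF: "deriv F v = 0" by (rule DERIV_imp_deriv)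
  have Fv: "F 0 = fst z" "F v = b"
    using F(4)[of 0] F(4)[OF v(1)] f(2,3) R by (auto simp: v_def)
  have "L_a0bV a b z \<le> elog (norm T * norm v ^ 2)"
    by (rule L_a0bV_le[OF F(1) g(1) _ T(2) v(1) _ _ dF]) (use F(3) Fv g in auto)
  also have "\<dots> \<le> elog Y"
    using v(3) T(2) mult_right_mono[of "norm T" 1 "norm v ^ 2"] by (intro elog_mono) auto
  finally show ?thesis .
qed

lemma mob_tendsto:
  assumes "(w \<longlongrightarrow> l) F" "(x \<longlongrightarrow> m) F" "1 - cnj l * m \<noteq> 0"
  shows "((\<lambda>n. mob (w n) (x n)) \<longlongrightarrow> mob l m) F"
  unfolding Moebius_function_simple using assms by (intro tendsto_intros) auto

text \<open>The uniform error at \<open>x n\<close> and the continuity of \<open>h\<close> combine.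
  The moving points will be the nodes of \<open>a\<close>.\<close>

lemma uniform_limit_tendsto_compose:
  fixes H :: "nat \<Rightarrow> 'a::topological_space \<Rightarrow> 'b::real_normed_vector"
  assumes "uniform_limit K H h sequentially" "\<And>n. n \<ge> N \<Longrightarrow> x n \<in> K" "x \<longlonglongrightarrow> l" "l \<in> K"
    "continuous_on K h"
  shows "(\<lambda>n. H n (x n)) \<longlonglongrightarrow> h l"
proof -
  have ev: "eventually (\<lambda>n. x n \<in> K) sequentially"
    by (rule eventually_sequentiallyI) (rule assms(2))
  have 1: "(\<lambda>n. h (x n)) \<longlonglongrightarrow> h l"
    by (rule continuous_on_tendsto_compose[OF assms(5,3,4) ev])
  have "(\<lambda>n. dist (H n (x n)) (h (x n))) \<longlonglongrightarrow> 0"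
  proof (rule order_tendstoI)
    fix e :: real assume "0 < e"
    then have "eventually (\<lambda>n. \<forall>z\<in>K. dist (H n z) (h z) < e) sequentially"
      by (rule uniform_limitD[OF assms(1)])
    with ev show "eventually (\<lambda>n. dist (H n (x n)) (h (x n)) < e) sequentially"
      by eventually_elim auto
  next
    fix c :: real assume "c < 0"
    then show "eventually (\<lambda>n. c < dist (H n (x n)) (h (x n))) sequentially"
      by (intro always_eventually allI) (rule less_le_trans[OF _ zero_le_dist])
  qed
  then have "(\<lambda>n. H n (x n) - h (x n)) \<longlonglongrightarrow> 0"
    by (simp add: dist_norm tendsto_norm_zero_iff)
  from Lim_transform[OF 1 this] show ?thesis .
qed

text \<open>Montel is applied to the quotients left after both zeros of \<open>mob b (F n z)\<close>
  are split off. The two factors merge into a square, so the limit visibly takes the value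
  \<open>b\<close> twice.\<close>

lemma L_a0bV_le_of_nodes_merging:
  assumes ab: "norm a < 1" "norm b < 1" and z1: "norm (fst z) < 1"
    and F: "\<And>n. self_map (F n)" "\<And>n. F n 0 = fst z" "\<And>n. F n (X1 n) = a"
      "\<And>n. F n (X2 n) = b" "\<And>n. F n (X3 n) = b"
    and X: "\<And>n. norm (X1 n) < 1" "\<And>n. norm (X2 n) < 1" "\<And>n. norm (X3 n) < 1" "\<And>n. X2 n \<noteq> X3 n"
    and k: "k < 1" "\<And>n. norm (X3 n) \<le> k"
    and merge: "(\<lambda>n. X2 n - X3 n) \<longlonglongrightarrow> 0"
    and z2: "0 < norm (snd z)" "\<And>n. norm (snd z) \<le> norm (X1 n) * norm (X2 n)"
    and Y: "\<And>n. norm (X1 n) * norm (X2 n) * norm (X3 n) \<le> Y" "Y < Y'"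
  shows "L_a0bV a b z \<le> elog Y'"
proof -
  have "\<exists>h. h holomorphic_on ball 0 1 \<and> (\<forall>z. norm z < 1 \<longrightarrow> norm (h z) \<le> 1) \<and>
      (\<forall>z. norm z < 1 \<longrightarrow> mob b (F n z) = mob (X2 n) z * mob (X3 n) z * h z)" for n
  proof -
    have Fb: "self_map (\<lambda>z. mob b (F n z))"
      by (rule self_map_mob_comp[OF F(1) ab(2)])
    obtain h where "h holomorphic_on ball 0 1" "\<And>z. norm z < 1 \<Longrightarrow> norm (h z) \<le> 1"
      "\<And>z. norm z < 1 \<Longrightarrow> mob b (F n z) = mob (X2 n) z * mob (X3 n) z * h z"
      by (rule Schwarz_factor_two[OF self_mapD(1)[OF Fb] _ X(2)[of n] X(3)[of n] X(4)[of n], of 1])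
         (use self_mapD(2)[OF Fb] F(4,5) in \<open>auto intro: less_imp_le simp: Moebius_function_eq_zero\<close>)
    then show ?thesis by blast
  qed
  then obtain H where H: "\<And>n. H n holomorphic_on ball 0 1" "\<And>n z. norm z < 1 \<Longrightarrow> norm (H n z) \<le> 1"
      "\<And>n z. norm z < 1 \<Longrightarrow> mob b (F n z) = mob (X2 n) z * mob (X3 n) z * H n z"
    by metis
  \<comment> \<open>Only \<open>X3\<close> is confined to a compact part of the open disc;
    \<open>X1\<close> may converge to the unit circle.\<close>
  have "compact (cball 0 1 \<times> cball 0 k :: (complex \<times> complex) set)"
    by (intro compact_Times compact_cball)
  then have "seq_compact (cball 0 1 \<times> cball 0 k :: (complex \<times> complex) set)"
    by (rule compact_imp_seq_compact)
  moreover have "\<forall>n. (X1 n, X3 n) \<in> cball 0 1 \<times> cball 0 k"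
    using X(1) k(2) by (auto intro: less_imp_le)
  ultimately obtain l r where l: "l \<in> cball 0 1 \<times> cball 0 k" "strict_mono (r :: nat \<Rightarrow> nat)"
      "((\<lambda>n. (X1 n, X3 n)) \<circ> r) \<longlonglongrightarrow> l"
    by (rule seq_compactE)
  define \<omega> \<xi> where "\<omega> = fst l" and "\<xi> = snd l"
  have l1: "norm \<omega> \<le> 1" "norm \<xi> \<le> k" using l(1) by (auto simp: \<omega>_def \<xi>_def mem_Times_iff)
  have \<xi>: "norm \<xi> < 1" using l1 k by linarith
  obtain h r' where h: "h holomorphic_on ball 0 1" "strict_mono (r' :: nat \<Rightarrow> nat)"
      "\<And>x. x \<in> ball 0 1 \<Longrightarrow> (\<lambda>n. (H \<circ> r) (r' n) x) \<longlonglongrightarrow> h x"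
      "\<And>K. compact K \<Longrightarrow> K \<subseteq> ball 0 1 \<Longrightarrow> uniform_limit K ((H \<circ> r) \<circ> r') h sequentially"
  proof (rule Montel[of "ball 0 1" "range H" "H \<circ> r"])
    show "\<exists>B. \<forall>h\<in>range H. \<forall>z\<in>K. norm (h z) \<le> B" if "K \<subseteq> ball 0 1" for K
      using that H(2) by (intro exI[of _ 1]) (auto simp: subset_iff)
  qed (use H(1) in auto)
  define s where "s = r \<circ> r'"
  have s: "strict_mono s" unfolding s_def using l(2) h(2) by (rule strict_mono_o)
  have l': "(\<lambda>n. (X1 (s n), X3 (s n))) \<longlonglongrightarrow> l"
    using LIMSEQ_subseq_LIMSEQ[OF l(3) h(2)] by (simp add: o_def s_def)
  have lim13: "(\<lambda>n. X1 (s n)) \<longlonglongrightarrow> \<omega>" "(\<lambda>n. X3 (s n)) \<longlonglongrightarrow> \<xi>"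
    using tendsto_fst[OF l'] tendsto_snd[OF l'] by (simp_all add: \<omega>_def \<xi>_def)
  have "(\<lambda>n. X2 (s n) - X3 (s n)) \<longlonglongrightarrow> 0"
    using LIMSEQ_subseq_LIMSEQ[OF merge s] by (simp add: o_def)
  from tendsto_add[OF this lim13(2)] have lim2: "(\<lambda>n. X2 (s n)) \<longlonglongrightarrow> \<xi>" by simp
  have Hlim: "(\<lambda>n. H (s n) x) \<longlonglongrightarrow> h x" if "norm x < 1" for x
    using h(3)[of x] that by (simp add: s_def)
  \<comment> \<open>Only the weak bound survives the limit; the strict bound on \<open>p\<close>
    comes from its factor \<open>mob \<xi>\<close>.\<close>
  have hb: "norm (h x) \<le> 1" if "norm x < 1" for x
    by (rule Lim_norm_ubound[OF _ Hlim[OF that]]) (use H(2) that in auto)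
  define p where "p = (\<lambda>x. mob \<xi> x * (mob \<xi> x * h x))"
  have "norm (mob \<xi> x * h x) \<le> 1" if "norm x < 1" for x
    using mult_le_one[of "norm (mob \<xi> x)" "norm (h x)"] hb[OF that]
      Moebius_function_norm_lt_1[OF \<xi> that] by (simp add: norm_mult less_imp_le)
  then have p: "self_map p"
    unfolding p_def
    by (intro self_map_mult self_map_mob \<xi> holomorphic_intros h(1) Moebius_function_holomorphic) auto
  define f where "f = (\<lambda>x. mob (-b) (p x))"
  have b': "norm (- b) < 1" using ab by simp
  have f: "self_map f" unfolding f_def by (rule self_map_mob_comp[OF p b'])
  \<comment> \<open>The factorisation passes to the limit along points \<open>y n\<close>. It is
    applied at the origin and along the moving node \<open>X1\<close>.\<close>
  have plim: "p x = mob b c" if "y \<longlonglongrightarrow> x" "\<And>n. norm (y n) < 1" "norm x < 1" "\<And>n. F (s n) (y n) = c"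
    "(\<lambda>n. H (s n) (y n)) \<longlonglongrightarrow> h x" for x y c
  proof -
    have "(\<lambda>n. mob (X2 (s n)) (y n) * mob (X3 (s n)) (y n) * H (s n) (y n))
        \<longlonglongrightarrow> mob \<xi> x * mob \<xi> x * h x"
      by (intro tendsto_mult mob_tendsto lim13 lim2 that mob_denom_nonzero \<xi>)
    moreover have "mob (X2 (s n)) (y n) * mob (X3 (s n)) (y n) * H (s n) (y n) = mob b c" for n
      using H(3)[OF that(2), of "s n" n] that(4) by simp
    ultimately show ?thesis
      using LIMSEQ_unique[OF _ tendsto_const] by (fastforce simp: p_def mult.assoc)
  qed
  have f0: "f 0 = fst z"
    using plim[of "\<lambda>_. 0" 0 "fst z"] Hlim[of 0] F(2) mob_inverse(1)[OF ab(2) z1] by (simp add: f_def)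
  have f\<xi>: "f \<xi> = b" by (simp add: f_def p_def Moebius_function_eq_zero Moebius_function_of_zero)
  have df: "deriv f \<xi> = 0"
  proof (rule DERIV_imp_deriv)
    have dm: "(mob \<xi> has_field_derivative deriv (mob \<xi>) \<xi>) (at \<xi>)"
      using Moebius_function_holomorphic[OF \<xi>, of 0] \<xi> by (auto intro: holomorphic_derivI)
    have dh: "(h has_field_derivative deriv h \<xi>) (at \<xi>)"
      using h(1) \<xi> by (auto intro: holomorphic_derivI)
    have p\<xi>: "p \<xi> = 0" by (simp add: p_def Moebius_function_eq_zero)
    have dp: "(p has_field_derivative 0) (at \<xi>)"
      unfolding p_def
      using DERIV_mult[OF dm DERIV_mult[OF dm dh]] by (simp add: Moebius_function_eq_zero)
    have "(mob (-b) has_field_derivative deriv (mob (-b)) 0) (at (p \<xi>))"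
      unfolding p\<xi> using Moebius_function_holomorphic[OF b', of 0] by (auto intro: holomorphic_derivI)
    from DERIV_chain2[OF this dp] show "(f has_field_derivative 0) (at \<xi>)"
      unfolding f_def by simp
  qed
  have z2': "norm (snd z) \<le> norm \<omega> * norm \<xi>"
    by (rule LIMSEQ_le_const[of "\<lambda>n. norm (X1 (s n)) * norm (X2 (s n))"])
       (use z2(2) in \<open>auto intro!: tendsto_intros lim13 lim2\<close>)
  have Ylim: "norm \<omega> * norm \<xi> * norm \<xi> \<le> Y"
    by (rule LIMSEQ_le_const2[of "\<lambda>n. norm (X1 (s n)) * norm (X2 (s n)) * norm (X3 (s n))"])
       (use Y(1) in \<open>auto intro!: tendsto_intros lim13 lim2\<close>)
  show ?thesis
  proof (cases "norm \<omega> < 1")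
    case True
    \<comment> \<open>This closed disc eventually contains \<open>X1 (s n)\<close>, and the
      convergence on it is uniform.\<close>
    define K where "K = cball (0::complex) ((1 + norm \<omega>) / 2)"
    have KS: "K \<subseteq> ball 0 1" using True by (auto simp: K_def)
    have "eventually (\<lambda>n. norm (X1 (s n)) < (1 + norm \<omega>) / 2) sequentially"
      by (rule order_tendstoD(2)[OF tendsto_norm[OF lim13(1)]]) (use True in simp)
    then obtain N where "\<And>n. n \<ge> N \<Longrightarrow> norm (X1 (s n)) < (1 + norm \<omega>) / 2"
      using eventually_sequentially by auto
    then have N: "\<And>n. n \<ge> N \<Longrightarrow> X1 (s n) \<in> K"
      by (simp add: K_def less_imp_le)
    have "(\<lambda>n. H (s n) (X1 (s n))) \<longlonglongrightarrow> h \<omega>"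
    proof (rule uniform_limit_tendsto_compose[OF _ N lim13(1)])
      show "uniform_limit K (\<lambda>n. H (s n)) h sequentially"
        using h(4)[OF _ KS] by (simp add: K_def s_def o_def)
      show "continuous_on K h"
        by (intro holomorphic_on_imp_continuous_on holomorphic_on_subset[OF h(1) KS])
    qed (use True in \<open>auto simp: K_def\<close>)
    then have "p \<omega> = mob b a"
      using plim[OF lim13(1) X(1) True] F(3) by blast
    then have f\<omega>: "f \<omega> = a" using mob_inverse(1)[OF ab(2,1)] by (simp add: f_def)
    obtain g where g: "self_map g" "g 0 = snd z" "g \<omega> = 0" "g \<xi> = 0"
      using ex_self_map_two_zeros[OF True \<xi> z2'] .
    have "L_a0bV a b z \<le> elog (norm \<omega> * norm \<xi> ^ 2)"
      by (rule L_a0bV_le[OF f g(1) _ True \<xi> _ _ df]) (use f0 f\<xi> f\<omega> g in auto)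
    also have "\<dots> \<le> elog Y'"
      using Ylim Y(2) by (intro elog_mono) (auto simp: power2_eq_square mult.assoc)
    finally show ?thesis .
  next
    case False
    then have \<omega>1: "norm \<omega> = 1" using l1 by simp
    show ?thesis
      by (rule L_a0bV_le_boundary[OF f f0 f\<xi> df ab(1) \<xi> z2(1)])
         (use z2' Ylim Y(2) in \<open>auto simp: \<omega>1 power2_eq_square\<close>)
  qed
qed

section \<open>The compactness argument\<close>

text \<open>Suppose competitors with small products exist along a null sequence. The bound for the
  two-pole function forces \<open>norm (snd z)\<close> above these products; then the second
  coordinate keeps \<open>X3\<close> away from the boundary and drives \<open>X2\<close> and
  \<open>X3\<close> together, which bounds \<open>L_a0bV\<close>.\<close>

lemma less_coman_lempert_three_eventually:
  fixes a b :: complex and z :: "complex \<times> complex"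
  assumes a: "norm a < 1" and b: "norm b < 1" and ab: "a \<noteq> b"
    and z: "norm (fst z) < 1" "norm (snd z) < 1"
    and y: "y < min (L_a0bV a b z) (coman_lempert [(a,0), (b,0)] z)"
  shows "eventually (\<lambda>\<epsilon>. y < coman_lempert [(a,0), (b,0), (b,\<epsilon>)] z) (at 0)"
proof (rule ccontr)
  assume not: "\<not> ?thesis"
  \<comment> \<open>Two levels above \<open>y\<close> are chosen: products of moduli stay below
    \<open>Y\<close>, both functions exceed \<open>elog Y'\<close>, and the gap between
    \<open>Y\<close> and \<open>Y'\<close> makes the estimates strict.\<close>
  obtain y1 where y1: "y < ereal y1" "ereal y1 < min (L_a0bV a b z) (coman_lempert [(a,0), (b,0)] z)"
    using ereal_dense2[OF y] by blast
  obtain y2 where y2: "ereal y1 < ereal y2" "ereal y2 < min (L_a0bV a b z) (coman_lempert [(a,0), (b,0)] z)"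
    using ereal_dense2[OF y1(2)] by blast
  define Y Y' where "Y = exp y1" and "Y' = exp y2"
  have YY: "0 < Y" "Y < Y'" using y2(1) by (auto simp: Y_def Y'_def)
  have LV: "elog Y' < L_a0bV a b z" and L2: "elog Y' < coman_lempert [(a,0), (b,0)] z"
    using y2(2) by (auto simp: Y'_def)
  have "\<exists>e f g x1 x2 x3. norm e < inverse (Suc n) \<and> e \<noteq> 0 \<and> self_map f \<and> self_map g \<and>
      (f 0, g 0) = z \<and> norm x1 < 1 \<and> norm x2 < 1 \<and> norm x3 < 1 \<and>
      (f x1, g x1) = (a, 0) \<and> (f x2, g x2) = (b, 0) \<and> (f x3, g x3) = (b, e) \<and>
      norm x1 * norm x2 * norm x3 < Y" for n :: nat
  proof -
    have "inverse (real (Suc n)) > 0" by simp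
    then obtain e where e: "e \<noteq> 0" "dist e 0 < inverse (real (Suc n))"
        "\<not> y < coman_lempert [(a,0), (b,0), (b,e)] z"
      using not unfolding eventually_at by blast
    have "coman_lempert [(a,0), (b,0), (b,e)] z < ereal y1" using e(3) y1(1) by simp
    then obtain f g x1 x2 x3 where *: "self_map f" "self_map g" "(f 0, g 0) = z"
      "norm x1 < 1" "norm x2 < 1" "norm x3 < 1"
      "(f x1, g x1) = (a, 0)" "(f x2, g x2) = (b, 0)" "(f x3, g x3) = (b, e)"
      "elog (norm x1 * norm x2 * norm x3) < ereal y1"
      by (rule coman_lempert_threeE)
    have "norm x1 * norm x2 * norm x3 < Y"
      unfolding Y_def by (rule elog_less_ereal[OF _ *(10)]) simp
    then show ?thesis
      using * e(1,2) by (intro exI[of _ e] exI[of _ f] exI[of _ g] exI[of _ x1] exI[of _ x2] exI[of _ x3]) auto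
  qed
  then have "\<forall>n. \<exists>e f g x1 x2 x3. norm e < inverse (Suc n) \<and> e \<noteq> 0 \<and> self_map f \<and> self_map g \<and>
      (f 0, g 0) = z \<and> norm x1 < 1 \<and> norm x2 < 1 \<and> norm x3 < 1 \<and>
      (f x1, g x1) = (a, 0) \<and> (f x2, g x2) = (b, 0) \<and> (f x3, g x3) = (b, e) \<and>
      norm x1 * norm x2 * norm x3 < Y" by blast
  then obtain e F G X1 X2 X3 where S: "\<forall>n. norm (e n) < inverse (Suc n) \<and> e n \<noteq> 0 \<and>
      self_map (F n) \<and> self_map (G n) \<and>
      (F n 0, G n 0) = z \<and> norm (X1 n) < 1 \<and> norm (X2 n) < 1 \<and> norm (X3 n) < 1 \<and>
      (F n (X1 n), G n (X1 n)) = (a, 0) \<and> (F n (X2 n), G n (X2 n)) = (b, 0) \<and>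
      (F n (X3 n), G n (X3 n)) = (b, e n) \<and>
      norm (X1 n) * norm (X2 n) * norm (X3 n) < Y"
    unfolding choice_iff by (elim exE) (rule that)
  then have e: "\<And>n. norm (e n) < inverse (Suc n)" "\<And>n. e n \<noteq> 0"
    and FG: "\<And>n. self_map (F n)" "\<And>n. self_map (G n)"
    and F: "\<And>n. F n 0 = fst z" "\<And>n. F n (X1 n) = a" "\<And>n. F n (X2 n) = b" "\<And>n. F n (X3 n) = b"
    and G: "\<And>n. G n 0 = snd z" "\<And>n. G n (X1 n) = 0" "\<And>n. G n (X2 n) = 0" "\<And>n. G n (X3 n) = e n"
    and X: "\<And>n. norm (X1 n) < 1" "\<And>n. norm (X2 n) < 1" "\<And>n. norm (X3 n) < 1"
    and prod: "\<And>n. norm (X1 n) * norm (X2 n) * norm (X3 n) < Y"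
    by auto
  have ne: "X1 n \<noteq> X2 n" "X2 n \<noteq> X3 n" for n
    using F(2,3)[of n] G(3,4)[of n] e(2)[of n] ab by auto
  define \<kappa> where "\<kappa> = norm (mob a b)"
  have \<kappa>: "0 < \<kappa>" using mob_eq_0_iff[OF a b] ab by (simp add: \<kappa>_def)
  \<comment> \<open>Otherwise Schwarz-Pick for a single competitor, the one with index 0, would
    bound the two-pole function by \<open>elog Y'\<close>.\<close>
  have z2Y: "Y' \<le> norm (snd z)"
  proof (rule ccontr)
    assume "\<not> Y' \<le> norm (snd z)"
    moreover have "norm (mob (fst z) a) \<le> norm (X1 0)"
      using Schwarz_Pick_mob[OF FG(1)[of 0], of 0 "X1 0"] X(1)[of 0] F(1,2)[of 0]
      by (simp add: Moebius_function_def)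
    moreover have "norm (mob (fst z) b) \<le> norm (X2 0) * norm (X3 0)"
    proof -
      have Fb: "self_map (\<lambda>z. mob b (F 0 z))"
        by (rule self_map_mob_comp[OF FG(1) b])
      have "norm (mob b (F 0 0)) \<le> norm (X2 0) * norm (X3 0)"
        by (rule third_zero_estimate(1)[OF Fb X(2,3) X(3) ne(2)])
           (use F in \<open>auto simp: Moebius_function_eq_zero\<close>)
      then show ?thesis using norm_mob_commute[OF b z(1)] F(1) by simp
    qed
    ultimately have "norm (mob (fst z) a) * norm (mob (fst z) b) \<le> norm (X1 0) * (norm (X2 0) * norm (X3 0))"
      by (intro mult_mono) auto
    then have "norm (mob (fst z) a) * norm (mob (fst z) b) < Y'"
      using prod[of 0] YY by (simp add: mult.assoc)
    moreover have "norm (mob (fst z) a) * norm (mob (fst z) b) < 1 * 1"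
      using Moebius_function_norm_lt_1[OF z(1) a] Moebius_function_norm_lt_1[OF z(1) b]
      by (intro mult_strict_mono) (auto intro: less_le_trans)
    ultimately have "max (norm (snd z)) (norm (mob (fst z) a) * norm (mob (fst z) b)) < min Y' 1"
      using \<open>\<not> Y' \<le> norm (snd z)\<close> z(2) by simp
    then obtain c where c: "max (norm (snd z)) (norm (mob (fst z) a) * norm (mob (fst z) b)) < c"
        "c < min Y' 1"
      using dense by blast
    have "coman_lempert [(a,0), (b,0)] z \<le> elog c"
      by (rule coman_lempert_two_le_max[OF a b z(1)]) (use c in auto)
    also have "\<dots> \<le> elog Y'"
      by (rule elog_mono) (use c in \<open>auto intro: order_trans[OF norm_ge_zero less_imp_le]\<close>)
    finally show False using L2 by simp
  qed
  have z20: "0 < norm (snd z)" using z2Y YY by linarith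
  have z2X: "norm (snd z) \<le> norm (X1 n) * norm (X2 n)" for n
    using third_zero_estimate(1)[OF FG(2) X(1,2,3) ne(1) G(2,3)] G(1) by metis
  \<comment> \<open>The first two nodes have product at least \<open>norm (snd z)\<close>, while all
    three stay below \<open>Y\<close>, so \<open>X3\<close> cannot approach the boundary.\<close>
  have X3k: "norm (X3 n) \<le> Y / norm (snd z)" for n
  proof -
    have "norm (snd z) * norm (X3 n) \<le> norm (X1 n) * norm (X2 n) * norm (X3 n)"
      by (intro mult_right_mono z2X) auto
    then show ?thesis using prod[of n] z20 by (simp add: field_simps)
  qed
  define C where "C = \<kappa> * (norm (snd z) - Y)"
  have C: "0 < C" using \<kappa> z2Y YY by (simp add: C_def)
  have close: "norm (X2 n - X3 n) \<le> 4 * inverse (Suc n) / C" for n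
  proof -
    define m where "m = norm (mob (X2 n) (X3 n))"
    define m1 where "m1 = norm (mob (X1 n) (X3 n))"
    \<comment> \<open>The first coordinate separates \<open>X1\<close> from \<open>X3\<close>
      because \<open>a\<close> and \<open>b\<close> differ, so in the third-zero estimate only the
      factor \<open>m\<close> can be small.\<close>
    have m1: "\<kappa> \<le> m1"
      using Schwarz_Pick_mob[OF FG(1) X(1) X(3), of n n n] F(2,4)[of n] by (simp add: \<kappa>_def m1_def)
    have m0: "0 \<le> m" by (simp add: m_def)
    have "norm (snd z) * (m1 * m) \<le> norm (X1 n) * norm (X2 n) * norm (X3 n) * (m1 * m) + 2 * norm (e n)"
      using third_zero_estimate(2)[OF FG(2)[of n] X(1)[of n] X(2)[of n] X(3)[of n] ne(1)[of n] G(2)[of n] G(3)[of n]] G(1,4)[of n] by (simp add: m_def m1_def)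
    also have "\<dots> \<le> Y * (m1 * m) + 2 * inverse (Suc n)"
      using e(1)[of n] prod[of n] m0 m1 \<kappa> by (intro add_mono mult_right_mono) auto
    finally have *: "(norm (snd z) - Y) * (m1 * m) \<le> 2 * inverse (Suc n)"
      by (simp add: algebra_simps)
    have "C * m = (norm (snd z) - Y) * (\<kappa> * m)" by (simp add: C_def)
    also have "\<dots> \<le> (norm (snd z) - Y) * (m1 * m)"
      using m0 m1 z2Y YY by (intro mult_left_mono mult_right_mono) auto
    finally have "m \<le> 2 * inverse (Suc n) / C" using C * by (simp add: pos_le_divide_eq mult.commute)
    moreover have "norm (X2 n - X3 n) \<le> 2 * m"
      unfolding m_def using norm_diff_le_mob[OF X(2,3)] by (simp add: norm_minus_commute)
    ultimately show ?thesis by simp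
  qed
  have "(\<lambda>n. 4 * inverse (real (Suc n)) / C) \<longlonglongrightarrow> 4 * 0 / C"
    using C by (intro tendsto_intros LIMSEQ_inverse_real_of_nat) auto
  then have lim0: "(\<lambda>n. 4 * inverse (real (Suc n)) / C) \<longlonglongrightarrow> 0"
    by simp
  have merge: "(\<lambda>n. X2 n - X3 n) \<longlonglongrightarrow> 0"
    by (rule Lim_null_comparison[OF always_eventually lim0]) (rule allI, rule close)
  have k1: "Y / norm (snd z) < 1" using z2Y YY z20 by simp
  have "L_a0bV a b z \<le> elog Y'"
    by (rule L_a0bV_le_of_nodes_merging[OF a b z(1) FG(1) F X ne(2) k1 X3k merge z20 z2X less_imp_le[OF prod] YY(2)])
  then show False using LV by simp
qed

text \<open>Convergence in the order sense also covers the limit \<open>-\<infinity>\<close>.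
  Compactness gives the lower half; for the upper half the two functions in the minimum are treated
  separately.\<close>

theorem mainTheorem15:
  fixes a b :: complex and z :: "complex \<times> complex"
  assumes "a \<in> ball 0 1" and "b \<in> ball 0 1" and "a \<noteq> b"
    and "fst z \<in> ball 0 1" and "snd z \<in> ball 0 1"
  shows "((\<lambda>\<epsilon>. coman_lempert [(a,0), (b,0), (b,\<epsilon>)] z) \<longlongrightarrow>
           min (L_a0bV a b z) (coman_lempert [(a,0), (b,0)] z)) (at 0)"
proof (rule order_tendstoI)
  have lt: "norm a < 1" "norm b < 1" "norm (fst z) < 1" "norm (snd z) < 1"
    using assms by auto
  fix y
  show "eventually (\<lambda>\<epsilon>. y < coman_lempert [(a,0), (b,0), (b,\<epsilon>)] z) (at 0)"
    if "y < min (L_a0bV a b z) (coman_lempert [(a,0), (b,0)] z)"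
    using less_coman_lempert_three_eventually[OF lt(1,2) assms(3) lt(3,4) that] .
  assume "min (L_a0bV a b z) (coman_lempert [(a,0), (b,0)] z) < y"
  then consider "L_a0bV a b z < y" | "coman_lempert [(a,0), (b,0)] z < y"
    by (auto simp: min_less_iff_disj)
  then show "eventually (\<lambda>\<epsilon>. coman_lempert [(a,0), (b,0), (b,\<epsilon>)] z < y) (at 0)"
  proof cases
    case 1
    then show ?thesis
      by (rule coman_lempert_three_eventually_less[OF lt(1,2) assms(3)])
  next
    case 2
    have "eventually (\<lambda>\<epsilon>. norm \<epsilon> < 1) (at (0::complex))"
      by (rule eventually_norm_less_1)
    then show ?thesis
    proof eventually_elim
      case (elim \<epsilon>)
      have "coman_lempert [(a,0), (b,0), (b,\<epsilon>)] z \<le> coman_lempert [(a,0), (b,0)] z"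
        by (rule coman_lempert_add_pole_le) (use elim lt in auto)
      then show ?case using 2 by simp
    qed
  qed
qed

end
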